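(* Let $1\le p<3$ and $k=2$. For $0<s<1/2$ let $K_s=K(1,s,s,2s)$, i.e. the convex quadrilateral with vertices $(0,0),(1,0),(s,2s),(0,s)$, let $h_s$ be its diameter, and let $u(x,y)=x(x-1/2)(x-1)$. All the $K_s$ satisfy $RDP(\sqrt5,\tfrac{3\pi}{4})$ and $MAC(\tfrac{3\pi}{4})$, but there is no $\psi_m>0$ such that every $K_s$ satisfies $mac(\psi_m)$. Moreover, there is no constant $C$ independent of $s$ such that $$|u-Q_2u|_{1,p,K_s}\le C\,h_s^2\,|u|_{3,p,K_s}\qquad\text{for all } 0<s<1/2 .$$
   Context: $|u|_{m,p,K}$ is the seminorm of $W^{m,p}(K)$ involving only the derivatives of order exactly $m$. A convex quadrilateral $K$ satisfies $mac(\psi_m)$ if every internal angle $\theta$ satisfies $0<\psi_m\le\theta$; it satisfies $MAC(\psi_M)$ if every internal angle satisfies $\theta\le\psi_M<\pi$. It satisfies the regular decomposition property $RDP(N,\psi_M)$, with $N\in\mathbb{R}$ and $0<\psi_M<\pi$, if $K$ can be divided into two triangles along one of its diagonals, called $d_1$ (the other diagonal being $d_2$), in such a way that $|d_2|/|d_1|\le N$ and both triangles have maximum angle bounded by $\psi_M$. Interpolation. Let $\widehat K=[0,1]^2$ with vertices $\widehat V_1=(0,0),\widehat V_2=(1,0),\widehat V_3=(1,1),\widehat V_4=(0,1)$. For a convex quadrilateral $K$ with vertices $V_1,\dots,V_4$ in counterclockwise order, let $F_K:\widehat K\to K$, $F_K(\hat x)=\sum_{i=1}^4 V_i\widehat\phi_i(\hat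 x)$, where $\widehat\phi_i$ is the bilinear function with $\widehat\phi_i(\widehat V_j)=\delta_{ij}$. Let $\widehat Q_k$ be the Lagrange interpolation operator on $\widehat K$ at the points $(j/k,i/k)$, $0\le i,j\le k$, onto the space $\mathcal{Q}_k$ of polynomials of degree at most $k$ in each variable. Then $Q_ku(X)=\widehat Q_k(u\circ F_K)(F_K^{-1}(X))$. *)

theory Defs
  imports "HOL-Analysis.Analysis" "HOL-Computational_Algebra.Polynomial"
begin

type_synonym point = "real \<times> real"

section \<open>Sobolev seminorms\<close>

fun C_k :: "nat \<Rightarrow> (point \<Rightarrow> real) \<Rightarrow> bool" where
  "C_k 0 f \<longleftrightarrow> continuous_on UNIV f"
| "C_k (Suc k) f \<longleftrightarrow> (\<forall>X. f differentiable (at X)) \<and>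
     (\<forall>b\<in>Basis. C_k k (\<lambda>X. frechet_derivative f (at X) b))"

definition test_function :: "point set \<Rightarrow> (point \<Rightarrow> real) \<Rightarrow> bool" where
  "test_function \<Omega> \<phi> \<longleftrightarrow> (\<forall>k. C_k k \<phi>) \<and>
     compact (closure {X. \<phi> X \<noteq> 0}) \<and> closure {X. \<phi> X \<noteq> 0} \<subseteq> \<Omega>"

definition partial :: "point \<Rightarrow> (point \<Rightarrow> real) \<Rightarrow> point \<Rightarrow> real" where
  "partial b f X = frechet_derivative f (at X) b"

definition D :: "nat \<times> nat \<Rightarrow> (point \<Rightarrow> real) \<Rightarrow> point \<Rightarrow> real" where
  "D \<alpha> f = (partial (1, 0) ^^ fst \<alpha>) ((partial (0, 1) ^^ snd \<alpha>) f)"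

definition locally_integrable :: "point set \<Rightarrow> (point \<Rightarrow> real) \<Rightarrow> bool" where
  "locally_integrable \<Omega> f \<longleftrightarrow> (\<forall>C. compact C \<and> C \<subseteq> \<Omega> \<longrightarrow> set_integrable lebesgue C f)"

definition has_weak_deriv ::
    "point set \<Rightarrow> nat \<times> nat \<Rightarrow> (point \<Rightarrow> real) \<Rightarrow> (point \<Rightarrow> real) \<Rightarrow> bool" where
  "has_weak_deriv \<Omega> \<alpha> f g \<longleftrightarrow> locally_integrable \<Omega> f \<and> locally_integrable \<Omega> g \<and>
     (\<forall>\<phi>. test_function \<Omega> \<phi> \<longrightarrow>
        (LINT X:\<Omega>|lebesgue. f X * D \<alpha> \<phi> X) =
        (- 1) ^ (fst \<alpha> + snd \<alpha>) * (LINT X:\<Omega>|lebesgue. g X * \<phi> X))"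

text \<open>A weak derivative on an open set is unique up to a null set, so that integrals over
  \<open>\<Omega>\<close> do not depend on the representative chosen here.\<close>

definition weak_deriv :: "point set \<Rightarrow> nat \<times> nat \<Rightarrow> (point \<Rightarrow> real) \<Rightarrow> point \<Rightarrow> real" where
  "weak_deriv \<Omega> \<alpha> f = (SOME g. has_weak_deriv \<Omega> \<alpha> f g)"

text \<open>The seminorm of order \<open>m\<close> on \<open>W\<^sup>m\<^sup>,\<^sup>p(\<Omega>)\<close>, for \<open>\<Omega>\<close> open and \<open>1 \<le> p < \<infinity>\<close>.
  The value is meaningful only for members of that space.\<close>

definition sobolev_seminorm :: "nat \<Rightarrow> real \<Rightarrow> point set \<Rightarrow> (point \<Rightarrow> real) \<Rightarrow> real" where
  "sobolev_seminorm m p \<Omega> f =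
     (\<Sum>\<alpha> | fst \<alpha> + snd \<alpha> = m. LINT X:\<Omega>|lebesgue. \<bar>weak_deriv \<Omega> \<alpha> f X\<bar> powr p) powr (1 / p)"

section \<open>Convex quadrilaterals\<close>

datatype quad = Quad (V1: point) (V2: point) (V3: point) (V4: point)

definition region :: "quad \<Rightarrow> point set" where
  "region K = convex hull {V1 K, V2 K, V3 K, V4 K}"

definition left_turn :: "point \<Rightarrow> point \<Rightarrow> point \<Rightarrow> bool" where
  "left_turn A B C \<longleftrightarrow>
     (fst B - fst A) * (snd C - snd B) - (snd B - snd A) * (fst C - fst B) > 0"

text \<open>Four left turns, each by less than \<open>\<pi>\<close>, add up to a single full turn; so the vertices are
  the corners of a nondegenerate convex quadrilateral in counterclockwise order.\<close>

definition convex_quad :: "quad \<Rightarrow> bool" where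
  "convex_quad K \<longleftrightarrow>
     left_turn (V1 K) (V2 K) (V3 K) \<and> left_turn (V2 K) (V3 K) (V4 K) \<and>
     left_turn (V3 K) (V4 K) (V1 K) \<and> left_turn (V4 K) (V1 K) (V2 K)"

text \<open>The angle at \<open>B\<close>.\<close>

definition vertex_angle :: "point \<Rightarrow> point \<Rightarrow> point \<Rightarrow> real" where
  "vertex_angle A B C = arccos (((A - B) \<bullet> (C - B)) / (norm (A - B) * norm (C - B)))"

text \<open>The internal angles of a convex quadrilateral are smaller than \<open>\<pi>\<close>, hence equal to the
  unoriented angles.\<close>

definition quad_angles :: "quad \<Rightarrow> real set" where
  "quad_angles K =
     {vertex_angle (V4 K) (V1 K) (V2 K), vertex_angle (V1 K) (V2 K) (V3 K),
      vertex_angle (V2 K) (V3 K) (V4 K), vertex_angle (V3 K) (V4 K) (V1 K)}"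

definition triangle_angles :: "point \<Rightarrow> point \<Rightarrow> point \<Rightarrow> real set" where
  "triangle_angles A B C = {vertex_angle C A B, vertex_angle A B C, vertex_angle B C A}"

definition mac :: "real \<Rightarrow> quad \<Rightarrow> bool" where
  "mac \<psi> K \<longleftrightarrow> 0 < \<psi> \<and> (\<forall>\<theta>\<in>quad_angles K. \<psi> \<le> \<theta>)"

definition MAC :: "real \<Rightarrow> quad \<Rightarrow> bool" where
  "MAC \<psi> K \<longleftrightarrow> \<psi> < pi \<and> (\<forall>\<theta>\<in>quad_angles K. \<theta> \<le> \<psi>)"

text \<open>The two disjuncts are the two choices of the dividing diagonal.\<close>

definition RDP :: "real \<Rightarrow> real \<Rightarrow> quad \<Rightarrow> bool" where
  "RDP N \<psi> K \<longleftrightarrow> 0 < \<psi> \<and> \<psi> < pi \<and>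
     (dist (V2 K) (V4 K) / dist (V1 K) (V3 K) \<le> N \<and>
        (\<forall>\<theta>\<in>triangle_angles (V1 K) (V2 K) (V3 K) \<union> triangle_angles (V1 K) (V3 K) (V4 K). \<theta> \<le> \<psi>)
      \<or> dist (V1 K) (V3 K) / dist (V2 K) (V4 K) \<le> N \<and>
        (\<forall>\<theta>\<in>triangle_angles (V1 K) (V2 K) (V4 K) \<union> triangle_angles (V2 K) (V3 K) (V4 K). \<theta> \<le> \<psi>))"

definition K_quad :: "real \<Rightarrow> real \<Rightarrow> real \<Rightarrow> real \<Rightarrow> quad" where
  "K_quad a b a' b' = Quad (0, 0) (a, 0) (a', b') (0, b)"

section \<open>Interpolation\<close>

definition Khat :: "point set" where
  "Khat = {0..1} \<times> {0..1}"

text \<open>The bilinear shape functions of the corners \<open>(0,0)\<close>, \<open>(1,0)\<close>, \<open>(1,1)\<close>, \<open>(0,1)\<close>.\<close>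

definition phi1 :: "point \<Rightarrow> real" where "phi1 = (\<lambda>(x, y). (1 - x) * (1 - y))"
definition phi2 :: "point \<Rightarrow> real" where "phi2 = (\<lambda>(x, y). x * (1 - y))"
definition phi3 :: "point \<Rightarrow> real" where "phi3 = (\<lambda>(x, y). x * y)"
definition phi4 :: "point \<Rightarrow> real" where "phi4 = (\<lambda>(x, y). (1 - x) * y)"

definition F :: "quad \<Rightarrow> point \<Rightarrow> point" where
  "F K X = phi1 X *\<^sub>R V1 K + phi2 X *\<^sub>R V2 K + phi3 X *\<^sub>R V3 K + phi4 X *\<^sub>R V4 K"

definition Q_space :: "nat \<Rightarrow> (point \<Rightarrow> real) set" where
  "Q_space k = {q. \<exists>c :: nat \<Rightarrow> nat \<Rightarrow> real. q = (\<lambda>(x, y). \<Sum>i\<le>k. \<Sum>j\<le>k. c i j * x ^ i * y ^ j)}"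

definition Qhat :: "nat \<Rightarrow> (point \<Rightarrow> real) \<Rightarrow> point \<Rightarrow> real" where
  "Qhat k v = (THE q. q \<in> Q_space k \<and>
     (\<forall>i\<le>k. \<forall>j\<le>k. q (real j / real k, real i / real k) = v (real j / real k, real i / real k)))"

definition Q_interp :: "nat \<Rightarrow> quad \<Rightarrow> (point \<Rightarrow> real) \<Rightarrow> point \<Rightarrow> real" where
  "Q_interp k K u X = Qhat k (u \<circ> F K) (the_inv_into Khat (F K) X)"

subsection \<open>Well-definedness of the interpolation operator\<close>

lemma lagrange_basis_exists:
  fixes k m :: nat
  assumes "k > 0" "m \<le> k"
  shows "\<exists>c :: nat \<Rightarrow> real. \<forall>i\<le>k. (\<Sum>l\<le>k. c l * (real i / real k) ^ l) = (if i = m then 1 else 0)"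
proof -
  define A where "A = {..k} - {m}"
  define P :: "real poly" where
    "P = smult (inverse (\<Prod>n\<in>A. real m / real k - real n / real k)) (\<Prod>n\<in>A. [:- (real n / real k), 1:])"
  have nz: "(\<Prod>n\<in>A. real m / real k - real n / real k) \<noteq> 0"
    using assms by (auto simp: A_def field_simps)
  have val: "poly P x = inverse (\<Prod>n\<in>A. real m / real k - real n / real k) * (\<Prod>n\<in>A. x - real n / real k)" for x
    by (simp add: P_def poly_prod)
  have "degree (\<Prod>n\<in>A. [:- (real n / real k), 1:]) \<le> (\<Sum>n\<in>A. degree [:- (real n / real k), 1:])"
    using degree_prod_sum_le[of A "\<lambda>n. [:- (real n / real k), 1:]"] by (simp add: A_def o_def)
  also have "\<dots> = k" using assms by (simp add: A_def)
  finally have deg: "degree P \<le> k" by (simp add: P_def)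
  have "(\<Sum>l\<le>k. coeff P l * x ^ l) = poly P x" for x
    unfolding poly_altdef using deg
    by (intro sum.mono_neutral_right) (auto simp: coeff_eq_0)
  moreover have "poly P (real i / real k) = (if i = m then 1 else 0)" if "i \<le> k" for i
    using nz that by (auto simp: val A_def)
  ultimately show ?thesis by (intro exI[of _ "coeff P"]) auto
qed

lemma zero_coeffs:
  fixes e :: "nat \<Rightarrow> real"
  assumes "k > 0" and z: "\<And>i. i \<le> k \<Longrightarrow> (\<Sum>l\<le>k. e l * (real i / real k) ^ l) = 0" and "m \<le> k"
  shows "e m = 0"
proof (rule ccontr)
  assume "e m \<noteq> 0"
  then have fin: "finite {x. (\<Sum>l\<le>k. e l * x ^ l) = 0}"
    and le: "card {x. (\<Sum>l\<le>k. e l * x ^ l) = 0} \<le> k"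
    using polyfun_rootbound[where c = e and n = k] assms(3) by blast+
  have "(\<lambda>i. real i / real k) ` {..k} \<subseteq> {x. (\<Sum>l\<le>k. e l * x ^ l) = 0}"
    using z by auto
  moreover have "inj_on (\<lambda>i. real i / real k) {..k}"
    using assms(1) by (auto simp: inj_on_def)
  ultimately have "card {..k} \<le> card {x. (\<Sum>l\<le>k. e l * x ^ l) = 0}"
    by (metis card_image card_mono fin)
  with le show False by simp
qed

lemma Qhat_ex1:
  assumes "k > 0"
  shows "\<exists>!q. q \<in> Q_space k \<and>
     (\<forall>i\<le>k. \<forall>j\<le>k. q (real j / real k, real i / real k) = v (real j / real k, real i / real k))"
proof (rule ex_ex1I)
  have "\<forall>m. \<exists>c :: nat \<Rightarrow> real. m \<le> k \<longrightarrow>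
      (\<forall>i\<le>k. (\<Sum>l\<le>k. c l * (real i / real k) ^ l) = (if i = m then 1 else 0))"
    using lagrange_basis_exists[OF assms] by auto
  then obtain d :: "nat \<Rightarrow> nat \<Rightarrow> real" where
    d: "\<And>m i. m \<le> k \<Longrightarrow> i \<le> k \<Longrightarrow> (\<Sum>l\<le>k. d m l * (real i / real k) ^ l) = (if i = m then 1 else 0)"
    by metis
  define V where "V m n = v (real m / real k, real n / real k)" for m n
  define c where "c a b = (\<Sum>m\<le>k. \<Sum>n\<le>k. V m n * d m a * d n b)" for a b
  define q where "q = (\<lambda>(x, y). \<Sum>a\<le>k. \<Sum>b\<le>k. c a b * x ^ a * y ^ b)"
  have eq: "q (x, y) = (\<Sum>m\<le>k. \<Sum>n\<le>k. V m n * (\<Sum>a\<le>k. d m a * x ^ a) * (\<Sum>b\<le>k. d n b * y ^ b))" for x y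
  proof -
    have "q (x, y) = (\<Sum>a\<le>k. \<Sum>b\<le>k. \<Sum>m\<le>k. \<Sum>n\<le>k. V m n * (d m a * x ^ a) * (d n b * y ^ b))"
      by (simp add: q_def c_def sum_distrib_left sum_distrib_right mult_ac)
    also have "\<dots> = (\<Sum>a\<le>k. \<Sum>m\<le>k. \<Sum>b\<le>k. \<Sum>n\<le>k. V m n * (d m a * x ^ a) * (d n b * y ^ b))"
      by (rule sum.cong[OF refl], rule sum.swap)
    also have "\<dots> = (\<Sum>m\<le>k. \<Sum>a\<le>k. \<Sum>b\<le>k. \<Sum>n\<le>k. V m n * (d m a * x ^ a) * (d n b * y ^ b))"
      by (rule sum.swap)
    also have "\<dots> = (\<Sum>m\<le>k. \<Sum>a\<le>k. \<Sum>n\<le>k. \<Sum>b\<le>k. V m n * (d m a * x ^ a) * (d n b * y ^ b))"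
      by (rule sum.cong[OF refl], rule sum.cong[OF refl], rule sum.swap)
    also have "\<dots> = (\<Sum>m\<le>k. \<Sum>n\<le>k. \<Sum>a\<le>k. \<Sum>b\<le>k. V m n * (d m a * x ^ a) * (d n b * y ^ b))"
      by (rule sum.cong[OF refl], rule sum.swap)
    also have "\<dots> = (\<Sum>m\<le>k. \<Sum>n\<le>k. \<Sum>b\<le>k. \<Sum>a\<le>k. V m n * (d m a * x ^ a) * (d n b * y ^ b))"
      by (rule sum.cong[OF refl], rule sum.cong[OF refl], rule sum.swap)
    finally show ?thesis
      by (simp add: sum_distrib_left sum_distrib_right)
  qed
  have "q (real j / real k, real i / real k) = v (real j / real k, real i / real k)"
    if "i \<le> k" "j \<le> k" for i j
  proof -
    have "q (real j / real k, real i / real k) =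
        (\<Sum>m\<le>k. \<Sum>n\<le>k. V m n * (if j = m then 1 else 0) * (if i = n then 1 else 0))"
      unfolding eq using that by (intro sum.cong refl) (simp add: d)
    also have "\<dots> = (\<Sum>m\<le>k. if j = m then V m i else 0)"
      using that by (intro sum.cong refl) (simp add: if_distrib cong: if_cong)
    also have "\<dots> = V j i" using that by simp
    finally show ?thesis by (simp add: V_def)
  qed
  moreover have "q \<in> Q_space k" by (auto simp: Q_space_def q_def)
  ultimately show "\<exists>q. q \<in> Q_space k \<and>
     (\<forall>i\<le>k. \<forall>j\<le>k. q (real j / real k, real i / real k) = v (real j / real k, real i / real k))"
    by blast
next
  fix q q'
  assume "q \<in> Q_space k \<and>
     (\<forall>i\<le>k. \<forall>j\<le>k. q (real j / real k, real i / real k) = v (real j / real k, real i / real k))"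
    and "q' \<in> Q_space k \<and>
     (\<forall>i\<le>k. \<forall>j\<le>k. q' (real j / real k, real i / real k) = v (real j / real k, real i / real k))"
  then obtain c c' where q: "q = (\<lambda>(x, y). \<Sum>a\<le>k. \<Sum>b\<le>k. c a b * x ^ a * y ^ b)"
    and q': "q' = (\<lambda>(x, y). \<Sum>a\<le>k. \<Sum>b\<le>k. c' a b * x ^ a * y ^ b)"
    and eq: "\<And>i j. i \<le> k \<Longrightarrow> j \<le> k \<Longrightarrow>
      q (real j / real k, real i / real k) = q' (real j / real k, real i / real k)"
    by (auto simp: Q_space_def)
  define e where "e a b = c a b - c' a b" for a b
  have "(\<Sum>a\<le>k. (\<Sum>b\<le>k. e a b * (real i / real k) ^ b) * (real j / real k) ^ a) = 0"
    if "i \<le> k" "j \<le> k" for i j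
  proof -
    have "(\<Sum>a\<le>k. (\<Sum>b\<le>k. e a b * (real i / real k) ^ b) * (real j / real k) ^ a) =
        q (real j / real k, real i / real k) - q' (real j / real k, real i / real k)"
      unfolding q q' e_def
      by (simp add: sum_subtractf sum_distrib_right sum_distrib_left algebra_simps)
    then show ?thesis using eq that by simp
  qed
  then have "(\<Sum>b\<le>k. e a b * (real i / real k) ^ b) = 0" if "a \<le> k" "i \<le> k" for a i
    using zero_coeffs[OF assms, of "\<lambda>a. \<Sum>b\<le>k. e a b * (real i / real k) ^ b"] that by blast
  then have "e a b = 0" if "a \<le> k" "b \<le> k" for a b
    using zero_coeffs[OF assms, of "e a"] that by blast
  then show "q = q'"
    unfolding q q' e_def by (auto simp: fun_eq_iff intro!: sum.cong)
qed

end

theory Submission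
  imports Defs
begin

text \<open>Why the estimate fails. Put \<open>t = 1 - s\<close>. The bilinear map of \<open>K\<^sub>s\<close> is
\<open>F(x, y) = (x (1 - t y), s y (1 + x))\<close>: its height is of order \<open>s\<close>, while its width stays of order 1.
Since \<open>u\<close> is a cubic in the first coordinate, \<open>u \<circ> F\<close> is cubic in \<open>x\<close> and in \<open>y\<close>, and the
biquadratic interpolant leaves an error that does not tend to 0 with \<open>s\<close>: in reference
coordinates it has a limit that depends on \<open>y\<close>. The derivative in the direction of height is
therefore of order \<open>1/s\<close> on a part of \<open>K\<^sub>s\<close> of measure of order \<open>s\<close>, so that the left side is at
least \<open>c s\<^bsup>1/p - 1\<^esup>\<close>. On the right side the diameter is at most 2 and \<open>u\<close> has third derivative 6 in
the first direction and no other, so that the seminorm is at most \<open>6 |K\<^sub>s|\<^bsup>1/p\<^esup>\<close>, of order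
\<open>s\<^bsup>1/p\<^esup>\<close>. The quotient grows like \<open>1/s\<close>.

The inverse of \<open>F\<close> is explicit. With \<open>m = t Y / s\<close>, the numbers \<open>1 + x\<close> and \<open>t y\<close> have sum
\<open>1 + X + m\<close> and product \<open>m\<close>, hence are the two roots of a quadratic equation. This expresses the error on \<open>K\<^sub>s\<close>
as a function of \<open>X\<close> and \<open>m\<close> (lemma \<open>Q_interp_error\<close>) that is smooth up to \<open>s = 0\<close>, and
reduces the lower bound to one evaluation at \<open>X = 1/2\<close>, \<open>m = 0\<close>, \<open>s = 0\<close>
(\<open>err_hat_m_bound_near\<close>). The two seminorm bounds are \<open>seminorm_1_ge\<close> and \<open>seminorm_3_le\<close>.

The seminorms are built from some weak derivative, chosen arbitrarily. To compute with them one needs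
that classical derivatives are weak derivatives (\<open>has_weak_deriv_classical\<close>, integration by parts)
and that weak derivatives are unique up to null sets (\<open>weak_deriv_unique\<close>, the fundamental
lemma of the calculus of variations); the latter rests on smooth bump functions that approximate
the indicator of a box.

Among the angles, the bound \<open>3\<pi>/4\<close> comes from the one at the vertex \<open>(0, s)\<close>, which equals \<open>3\<pi>/4\<close> for every \<open>s\<close>, while
the angle at \<open>(1, 0)\<close> tends to 0.\<close>

section \<open>Smooth bump functions\<close>

lemma C_k_mono: "C_k (Suc k) f \<Longrightarrow> C_k k f"
proof (induction k arbitrary: f)
  case 0
  then show ?case
    by (auto intro!: differentiable_imp_continuous_on simp: differentiable_on_def)
next
  case (Suc k)
  then show ?case by (metis C_k.simps(2))
qed

lemma C_k_add:
  assumes "C_k k f" "C_k k g"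
  shows "C_k k (\<lambda>X. f X + g X)"
  using assms
proof (induction k arbitrary: f g)
  case 0
  then show ?case by (auto intro: continuous_intros)
next
  case (Suc k)
  have "frechet_derivative (\<lambda>X. f X + g X) (at X) =
      (\<lambda>b. frechet_derivative f (at X) b + frechet_derivative g (at X) b)" for X
    using Suc.prems
    by (intro frechet_derivative_at[symmetric] has_derivative_add)
       (auto simp: frechet_derivative_works simp del: split_paired_All)
  then show ?case using Suc by (auto intro: differentiable_add)
qed

lemma C_k_mult:
  assumes "C_k k f" "C_k k g"
  shows "C_k k (\<lambda>X. f X * g X)"
  using assms
proof (induction k arbitrary: f g)
  case 0
  then show ?case by (auto intro: continuous_intros)
next
  case (Suc k)
  have "frechet_derivative (\<lambda>X. f X * g X) (at X) =
      (\<lambda>b. f X * frechet_derivative g (at X) b + frechet_derivative f (at X) b * g X)" for X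
    using Suc.prems
    by (intro frechet_derivative_at[symmetric] has_derivative_mult)
       (auto simp: frechet_derivative_works simp del: split_paired_All)
  then show ?case using Suc C_k_mono[OF Suc.prems(1)] C_k_mono[OF Suc.prems(2)]
    by (auto intro!: differentiable_mult C_k_add Suc.IH)
qed

lemma C_k_const: "C_k k (\<lambda>X. c)"
  by (induction k arbitrary: c) (auto simp: frechet_derivative_const)

text \<open>Allowing a polynomial factor in \<open>1/x\<close> in front of \<open>exp (- 1/x)\<close> gives a family of functions
that is closed under differentiation, so that smoothness follows by induction over the order for
all members at once.\<close>

definition flat :: "real poly \<Rightarrow> real \<Rightarrow> real" where
  "flat P x = (if x > 0 then poly P (1 / x) * exp (- (1 / x)) else 0)"

lemma poly_exp_tendsto_0: "((\<lambda>z. poly P z * exp (- z)) \<longlongrightarrow> (0::real)) at_top"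
proof -
  have "((\<lambda>z. \<Sum>i\<le>degree P. coeff P i * (z ^ i / exp z)) \<longlongrightarrow> (\<Sum>i\<le>degree P. coeff P i * 0)) at_top"
    by (intro tendsto_sum tendsto_mult tendsto_const tendsto_power_div_exp_0)
  then show ?thesis
    by (simp add: poly_altdef exp_minus divide_inverse sum_distrib_right mult.assoc)
qed

lemma flat_tendsto_0: "(flat P \<longlongrightarrow> 0) (at 0)"
proof -
  have "((\<lambda>x. poly P (inverse x) * exp (- inverse x)) \<longlongrightarrow> (0::real)) (at_right 0)"
    using filterlim_compose[OF poly_exp_tendsto_0 filterlim_inverse_at_top_right] .
  then have "(flat P \<longlongrightarrow> 0) (at_right 0)"
    by (rule Lim_transform_eventually)
       (auto simp: flat_def eventually_at_filter divide_inverse)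
  moreover have "(flat P \<longlongrightarrow> 0) (at_left 0)"
    by (rule tendsto_eventually) (auto simp: flat_def eventually_at_filter)
  ultimately show ?thesis by (simp add: filterlim_split_at)
qed

lemma flat_deriv:
  "(flat P has_real_derivative flat (monom 1 2 * (P - pderiv P)) x) (at x)"
proof -
  consider "x > 0" | "x = 0" | "x < 0" by linarith
  then show ?thesis
  proof cases
    case 1
    have "((\<lambda>x. poly P (1 / x) * exp (- (1 / x))) has_real_derivative
        flat (monom 1 2 * (P - pderiv P)) x) (at x)"
      using 1
      by (auto intro!: derivative_eq_intros DERIV_chain'[OF _ poly_DERIV]
        simp: flat_def poly_monom power2_eq_square field_simps)
    then show ?thesis
      by (rule DERIV_cong_ev[OF refl _ refl, THEN iffD1, rotated])
         (use 1 in \<open>auto simp: flat_def intro!: eventually_mono[OF eventually_nhds_in_open[of "{0<..}"]]\<close>)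
  next
    case 2
    have "((\<lambda>h. (flat P h - flat P 0) / (h - 0)) \<longlongrightarrow> 0) (at 0)"
      by (rule Lim_transform_eventually[OF flat_tendsto_0[of "monom 1 1 * P"]])
         (auto simp: flat_def poly_monom eventually_at_filter)
    then show ?thesis using 2 by (simp add: has_field_derivative_iff flat_def)
  next
    case 3
    have "((\<lambda>x. 0) has_real_derivative 0) (at x)" by simp
    then have "(flat P has_real_derivative 0) (at x)"
      by (rule DERIV_cong_ev[OF refl _ refl, THEN iffD1, rotated])
         (use 3 in \<open>auto simp: flat_def intro!: eventually_mono[OF eventually_nhds_in_open[of "{..<0}"]]\<close>)
    then show ?thesis using 3 by (simp add: flat_def)
  qed
qed

lemma C_k_flat_affine: "C_k k (\<lambda>X. flat P (c \<bullet> X + d))"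
proof (induction k arbitrary: P)
  case 0
  have "continuous_on UNIV (flat P)"
    by (rule DERIV_continuous_on, rule has_field_derivative_at_within, rule flat_deriv)
  then show ?case
    unfolding C_k.simps
    by (rule continuous_on_compose2[of UNIV "flat P" UNIV]) (auto intro!: continuous_intros)
next
  case (Suc k)
  let ?P = "monom 1 2 * (P - pderiv P)"
  have der: "((\<lambda>X. flat P (c \<bullet> X + d)) has_derivative
      (\<lambda>b. (c \<bullet> b) * flat ?P (c \<bullet> X + d))) (at X)" for X
    by (rule DERIV_compose_FDERIV[OF flat_deriv])
       (auto intro!: derivative_eq_intros)
  have "frechet_derivative (\<lambda>X. flat P (c \<bullet> X + d)) (at X) =
      (\<lambda>b. (c \<bullet> b) * flat ?P (c \<bullet> X + d))" for X
    by (rule frechet_derivative_at[OF der, symmetric])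
  moreover have "(\<lambda>X. flat P (c \<bullet> X + d)) differentiable (at X)" for X
    using der unfolding differentiable_def by blast
  ultimately show ?case using Suc by (auto intro!: C_k_mult C_k_const)
qed

text \<open>Since \<open>flat 1 (n r) = exp (- 1/(n r))\<close> tends to 1 for every \<open>r > 0\<close> as \<open>n\<close> grows, mere
rescaling of the argument turns a fixed smooth function into approximations of the indicator of
the box, all with values in \<open>[0, 1]\<close> and vanishing outside that same box.\<close>

definition bump :: "point \<Rightarrow> point \<Rightarrow> nat \<Rightarrow> point \<Rightarrow> real" where
  "bump a b n X = (\<Prod>c\<in>Basis. flat 1 (n * (c \<bullet> (X - a))) * flat 1 (n * (c \<bullet> (b - X))))"

lemma flat_bounds: "0 \<le> flat 1 x" "flat 1 x \<le> 1"
  by (auto simp: flat_def)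

lemma C_k_prod: "finite I \<Longrightarrow> (\<And>i. i \<in> I \<Longrightarrow> C_k k (f i)) \<Longrightarrow> C_k k (\<lambda>X. \<Prod>i\<in>I. f i X)"
  by (induction I rule: finite_induct) (auto intro: C_k_const C_k_mult)

lemma C_k_bump: "C_k k (bump a b n)"
proof -
  have "C_k k (\<lambda>X. flat 1 (n * (c \<bullet> (X - a))) * flat 1 (n * (c \<bullet> (b - X))))" for c
  proof (rule C_k_mult)
    show "C_k k (\<lambda>X. flat 1 (n * (c \<bullet> (X - a))))"
      using C_k_flat_affine[of k 1 "n *\<^sub>R c" "- (n * (c \<bullet> a))"] by (simp add: algebra_simps)
    show "C_k k (\<lambda>X. flat 1 (n * (c \<bullet> (b - X))))"
      using C_k_flat_affine[of k 1 "- (n *\<^sub>R c)" "n * (c \<bullet> b)"] by (simp add: algebra_simps)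
  qed
  then show ?thesis unfolding bump_def[abs_def] by (intro C_k_prod) auto
qed

lemma bump_bounds: "0 \<le> bump a b n X" "bump a b n X \<le> 1"
  unfolding bump_def by (auto intro!: prod_nonneg prod_le_1 mult_le_one flat_bounds mult_nonneg_nonneg)

lemma bump_outside: "X \<notin> box a b \<Longrightarrow> bump a b n X = 0"
proof -
  assume "X \<notin> box a b"
  then obtain c where "c \<in> Basis" and "c \<bullet> (X - a) \<le> 0 \<or> c \<bullet> (b - X) \<le> 0"
    by (auto simp: mem_box inner_diff_right inner_commute not_less)
  then have "flat 1 (n * (c \<bullet> (X - a))) * flat 1 (n * (c \<bullet> (b - X))) = 0"
    by (auto simp: flat_def zero_less_mult_iff)
  with \<open>c \<in> Basis\<close> show "bump a b n X = 0"
    unfolding bump_def by (intro prod_zero) auto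
qed

lemma bump_tendsto:
  "(\<lambda>n. bump a b n X) \<longlonglongrightarrow> indicator (box a b) X"
proof (cases "X \<in> box a b")
  case True
  have *: "(\<lambda>n. flat 1 (real n * r)) \<longlonglongrightarrow> 1" if "r > 0" for r
  proof -
    have "(\<lambda>n. exp (- (inverse (real n) * (1 / r)))) \<longlonglongrightarrow> exp (- (0 * (1 / r)))"
      by (intro tendsto_intros lim_inverse_n)
    then have "(\<lambda>n. exp (- (inverse (real n) * (1 / r)))) \<longlonglongrightarrow> 1" by simp
    then show ?thesis
    proof (rule Lim_transform_eventually)
      show "\<forall>\<^sub>F n in sequentially. exp (- (inverse (real n) * (1 / r))) = flat 1 (real n * r)"
        using eventually_gt_at_top[of "0::nat"]
        by eventually_elim (use that in \<open>auto simp: flat_def field_simps\<close>)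
    qed
  qed
  have "(\<lambda>n. bump a b n X) \<longlonglongrightarrow> (\<Prod>c\<in>(Basis::point set). 1 * 1)"
    unfolding bump_def using True
    by (intro tendsto_prod tendsto_mult *) (auto simp: box_def inner_commute algebra_simps)
  then show ?thesis using True by simp
next
  case False
  then show ?thesis by (simp add: bump_outside)
qed

lemma test_function_bump:
  assumes "cbox a b \<subseteq> \<Omega>"
  shows "test_function \<Omega> (bump a b n)"
proof -
  have "closure {X. bump a b n X \<noteq> 0} \<subseteq> cbox a b"
  proof (rule closure_minimal)
    show "{X. bump a b n X \<noteq> 0} \<subseteq> cbox a b"
      using bump_outside[of _ a b n] box_subset_cbox[of a b] by blast
  qed (rule closed_cbox)
  moreover have "compact (closure {X. bump a b n X \<noteq> 0})"
    using calculation bounded_subset[OF bounded_cbox] by (meson closure_subset compact_closure order_trans)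
  ultimately show ?thesis using assms C_k_bump by (auto simp: test_function_def)
qed

section \<open>Uniqueness of weak derivatives\<close>

text \<open>Boxes are stable under intersection and generate the Borel sets, so the integrals vanish over all
Borel sets. Since \<open>g\<close> is only Lebesgue measurable, it is first replaced by a Borel function
that agrees with it almost everywhere.\<close>

lemma AE_zero_on_box:
  fixes g :: "'a::euclidean_space \<Rightarrow> real"
  assumes int: "set_integrable lebesgue (box c d) g"
    and zero: "\<And>a b. box a b \<subseteq> box c d \<Longrightarrow> (LINT X:box a b|lebesgue. g X) = 0"
  shows "AE X in lebesgue. X \<in> box c d \<longrightarrow> g X = 0"
proof -
  define G where "G X = indicator (box c d) X * g X" for X
  have G: "integrable lebesgue G"
    using int by (simp add: set_integrable_def G_def[abs_def])
  then obtain g' where g'[measurable]: "g' \<in> borel_measurable lborel" and "AE X in lborel. G X = g' X"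
    using completion_ex_borel_measurable_real borel_measurable_integrable by blast
  then have ae: "AE X in lebesgue. G X = g' X" by (intro AE_completion)
  have [measurable]: "g' \<in> borel_measurable lebesgue" by (rule measurable_completion) simp
  have int': "integrable lborel g'"
    using integrable_cong_AE_imp[OF G _ ae] by (simp add: integrable_completion)
  have eq: "(LINT X:A|lborel. g' X) = (LINT X:A|lebesgue. G X)" if [measurable]: "A \<in> sets borel" for A
  proof -
    have "(LINT X:A|lborel. g' X) = (LINT X:A|lebesgue. g' X)"
      unfolding set_lebesgue_integral_def by (rule integral_completion[symmetric]) simp
    also have "\<dots> = (LINT X:A|lebesgue. G X)"
      using G ae by (intro set_lebesgue_integral_cong_AE) (auto elim: eventually_mono)
    finally show ?thesis .
  qed
  have zero_box: "(LINT X:box a b|lborel. g' X) = 0" for a b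
  proof -
    obtain e f where ef: "box a b \<inter> box c d = box e f" using box_Int_box by blast
    have "(LINT X:box a b|lborel. g' X) = (LINT X:box a b|lebesgue. G X)"
      by (rule eq) simp
    also have "\<dots> = (LINT X:box e f|lebesgue. g X)"
      unfolding set_lebesgue_integral_def G_def ef[symmetric] indicator_inter_arith
      by (simp add: mult.assoc)
    also have "\<dots> = 0" using zero[of e f] ef by blast
    finally show ?thesis .
  qed
  have zero_all: "(LINT X|lborel. g' X) = 0"
  proof -
    have "(LINT X|lborel. g' X) = (LINT X:UNIV|lebesgue. G X)"
      using eq[of UNIV] by (simp add: set_lebesgue_integral_def)
    also have "\<dots> = (LINT X:box c d|lebesgue. g X)"
      by (simp add: set_lebesgue_integral_def G_def)
    finally show ?thesis using zero[of c d] by simp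
  qed
  have set_int: "set_integrable lborel A g'" if "A \<in> sets borel" for A
    using int' that set_integrable_subset[of lborel UNIV g' A] by (simp add: set_integrable_def)
  have "(LINT X:A|lborel. g' X) = 0" if "A \<in> sets borel" for A
  proof -
    have "Int_stable (range (\<lambda>(a, b). box a b :: 'a set))"
      by (auto simp: Int_stable_def box_Int_box)
    moreover have "(range (\<lambda>(a, b). box a b :: 'a set)) \<subseteq> Pow UNIV"
      by auto
    moreover have "A \<in> sigma_sets UNIV (range (\<lambda>(a, b). box a b))"
      using that unfolding borel_eq_box by simp
    ultimately show ?thesis
    proof (induction rule: sigma_sets_induct_disjoint)
      case (basic A)
      then show ?case using zero_box by auto
    next
      case empty
      then show ?case by (simp add: set_lebesgue_integral_def)
    next
      case (compl A)
      then have A: "A \<in> sets borel" by (simp add: borel_eq_box)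
      have "(LINT X:UNIV - A|lborel. g' X) = (LINT X|lborel. g' X - indicator A X *\<^sub>R g' X)"
        unfolding set_lebesgue_integral_def
        by (intro Bochner_Integration.integral_cong) (auto simp: indicator_def)
      also have "\<dots> = (LINT X|lborel. g' X) - (LINT X:A|lborel. g' X)"
        unfolding set_lebesgue_integral_def
        by (intro Bochner_Integration.integral_diff int' set_int[OF A, unfolded set_integrable_def])
      finally show ?case using compl zero_all by simp
    next
      case (union A)
      then have "A i \<in> sets borel" for i by (auto simp: borel_eq_box)
      then have "(LINT X:\<Union>(range A)|lborel. g' X) = (\<Sum>i. LINT X:A i|lborel. g' X)"
        using union(1)
        by (intro lebesgue_integral_countable_add set_int) (auto simp: disjoint_family_on_def)
      then show ?case using union by simp
    qed
  qed
  then have "AE X in lborel. g' X = 0"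
    by (intro density_unique_real int') auto
  then have "AE X in lebesgue. g' X = 0" by (rule AE_completion)
  with ae show ?thesis by eventually_elim (auto simp: G_def)
qed

text \<open>Dominated convergence, with \<open>\<bar>g\<bar>\<close> on the closed box as dominating function.\<close>

lemma bump_integral_tendsto:
  assumes g: "locally_integrable \<Omega> g" and sub: "cbox a b \<subseteq> \<Omega>"
  shows "(\<lambda>n. LINT X:\<Omega>|lebesgue. g X * bump a b n X) \<longlonglongrightarrow> (LINT X:box a b|lebesgue. g X)"
proof -
  have int: "integrable lebesgue (\<lambda>X. indicator (cbox a b) X *\<^sub>R g X)"
    using g[unfolded locally_integrable_def, rule_format, of "cbox a b"] sub
    by (simp add: set_integrable_def)
  have [measurable]: "bump a b n \<in> borel_measurable lebesgue" for n
    using C_k_bump[of 0 a b n]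
    by (intro measurable_completion) (simp add: borel_measurable_continuous_onI)
  have "bump a b n X = 0 \<or> X \<in> cbox a b" for n X
    using bump_outside[of X a b n] box_subset_cbox[of a b] by blast
  then have 1: "(LINT X:\<Omega>|lebesgue. g X * bump a b n X) =
      (LINT X|lebesgue. indicator (cbox a b) X *\<^sub>R g X * bump a b n X)" for n
    unfolding set_lebesgue_integral_def using sub
    by (intro Bochner_Integration.integral_cong) (force simp: indicator_def)+
  have 2: "(LINT X:box a b|lebesgue. g X) =
      (LINT X|lebesgue. indicator (cbox a b) X *\<^sub>R g X * indicator (box a b) X)"
    unfolding set_lebesgue_integral_def using box_subset_cbox[of a b]
    by (intro Bochner_Integration.integral_cong) (auto simp: indicator_def)
  show ?thesis unfolding 1 2
  proof (rule integral_dominated_convergence)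
    show "integrable lebesgue (\<lambda>X. norm (indicator (cbox a b) X *\<^sub>R g X))"
      using int by (rule integrable_norm)
    show "AE X in lebesgue. (\<lambda>n. indicator (cbox a b) X *\<^sub>R g X * bump a b n X)
        \<longlonglongrightarrow> indicator (cbox a b) X *\<^sub>R g X * indicator (box a b) X"
      by (intro always_eventually allI tendsto_mult tendsto_const bump_tendsto)
    show "AE X in lebesgue. norm (indicator (cbox a b) X *\<^sub>R g X * bump a b n X)
        \<le> norm (indicator (cbox a b) X *\<^sub>R g X)" for n
      using bump_bounds[of a b n]
      by (intro always_eventually allI) (simp add: abs_mult mult_left_le)
    have [measurable]: "(\<lambda>X. indicator (cbox a b) X *\<^sub>R g X) \<in> borel_measurable lebesgue"
      using int by (rule borel_measurable_integrable)
    have [measurable]: "box a b \<in> sets lebesgue" by simp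
    show "(\<lambda>X. indicator (cbox a b) X *\<^sub>R g X * indicator (box a b) X) \<in> borel_measurable lebesgue"
      by measurable
    show "(\<lambda>X. indicator (cbox a b) X *\<^sub>R g X * bump a b n X) \<in> borel_measurable lebesgue" for n
      by measurable
  qed
qed

lemma has_weak_derivD:
  assumes "has_weak_deriv \<Omega> \<alpha> f g" "test_function \<Omega> \<phi>"
  shows "(LINT X:\<Omega>|lebesgue. f X * D \<alpha> \<phi> X) =
    (- 1) ^ (fst \<alpha> + snd \<alpha>) * (LINT X:\<Omega>|lebesgue. g X * \<phi> X)"
  using assms by (simp add: has_weak_deriv_def)

text \<open>Testing with bump functions shows that both derivatives have the same integral over each box whose closure lies
in \<open>\<Omega>\<close>; countably many such boxes cover \<open>\<Omega>\<close>.\<close>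

lemma weak_deriv_unique:
  assumes "open \<Omega>" and g: "has_weak_deriv \<Omega> \<alpha> f g" and g': "has_weak_deriv \<Omega> \<alpha> f g'"
  shows "AE X in lebesgue. X \<in> \<Omega> \<longrightarrow> g X = g' X"
proof -
  have eq: "(LINT X:box a b|lebesgue. g X) = (LINT X:box a b|lebesgue. g' X)" if sub: "cbox a b \<subseteq> \<Omega>" for a b
  proof (rule LIMSEQ_unique)
    show "(\<lambda>n. LINT X:\<Omega>|lebesgue. g X * bump a b n X) \<longlonglongrightarrow> (LINT X:box a b|lebesgue. g X)"
      using g sub by (intro bump_integral_tendsto) (auto simp: has_weak_deriv_def)
    have "(LINT X:\<Omega>|lebesgue. g X * bump a b n X) = (LINT X:\<Omega>|lebesgue. g' X * bump a b n X)" for n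
    proof -
      have "(- 1) ^ (fst \<alpha> + snd \<alpha>) * (LINT X:\<Omega>|lebesgue. g X * bump a b n X) =
            (- 1) ^ (fst \<alpha> + snd \<alpha>) * (LINT X:\<Omega>|lebesgue. g' X * bump a b n X)"
        using has_weak_derivD[OF g test_function_bump[OF sub, of n]]
          has_weak_derivD[OF g' test_function_bump[OF sub, of n]]
        by simp
      then show ?thesis by simp
    qed
    moreover have "(\<lambda>n. LINT X:\<Omega>|lebesgue. g' X * bump a b n X) \<longlonglongrightarrow> (LINT X:box a b|lebesgue. g' X)"
      using g' sub by (intro bump_integral_tendsto) (auto simp: has_weak_deriv_def)
    ultimately show "(\<lambda>n. LINT X:\<Omega>|lebesgue. g X * bump a b n X) \<longlonglongrightarrow> (LINT X:box a b|lebesgue. g' X)"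
      by simp
  qed
  have int: "set_integrable lebesgue (box a b) h"
    if "has_weak_deriv \<Omega> \<alpha> f h" "cbox a b \<subseteq> \<Omega>" for a b h
  proof -
    have "set_integrable lebesgue (cbox a b) h"
      using that by (auto simp: has_weak_deriv_def locally_integrable_def)
    then show ?thesis by (rule set_integrable_subset) (auto simp: box_subset_cbox)
  qed
  have box: "AE X in lebesgue. X \<in> box c d \<longrightarrow> g X - g' X = 0" if sub: "cbox c d \<subseteq> \<Omega>" for c d
  proof (rule AE_zero_on_box)
    show "set_integrable lebesgue (box c d) (\<lambda>X. g X - g' X)"
      using int[OF g sub] int[OF g' sub] by simp
    show "(LINT X:box a b|lebesgue. g X - g' X) = 0" if "box a b \<subseteq> box c d" for a b
    proof (cases "box a b = {}")
      case False
      have "cbox a b \<subseteq> cbox c d"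
        using closure_mono[OF that] closure_box[OF False] box_subset_cbox[of c d] closed_cbox
        by (metis closure_minimal order_trans)
      with sub have "cbox a b \<subseteq> \<Omega>" by blast
      then show ?thesis using eq int[OF g] int[OF g'] by simp
    qed (simp add: set_lebesgue_integral_def)
  qed
  define \<F> where "\<F> = {box c d | c d. cbox c d \<subseteq> \<Omega>}"
  have "\<Union>\<F> = \<Omega>"
  proof
    show "\<Union>\<F> \<subseteq> \<Omega>" using box_subset_cbox by (fastforce simp: \<F>_def)
    show "\<Omega> \<subseteq> \<Union>\<F>"
    proof
      fix X assume "X \<in> \<Omega>"
      then obtain c d where "cbox c d \<subseteq> \<Omega>" "X \<in> box c d"
        by (rule open_contains_cbox[OF \<open>open \<Omega>\<close>])
      then show "X \<in> \<Union>\<F>" unfolding \<F>_def by blast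
    qed
  qed
  moreover obtain \<F>' where "\<F>' \<subseteq> \<F>" "countable \<F>'" "\<Union>\<F>' = \<Union>\<F>"
    by (rule Lindelof[of \<F>]) (auto simp: \<F>_def open_box)
  moreover from this have "AE X in lebesgue. \<forall>B\<in>\<F>'. X \<in> B \<longrightarrow> g X - g' X = 0"
    using box by (subst AE_ball_countable) (auto simp: \<F>_def)
  ultimately show ?thesis by (auto elim!: eventually_mono)
qed

lemma weak_deriv_AE:
  assumes "open \<Omega>" "has_weak_deriv \<Omega> \<alpha> f g"
  shows "AE X in lebesgue. X \<in> \<Omega> \<longrightarrow> weak_deriv \<Omega> \<alpha> f X = g X"
  using weak_deriv_unique[OF assms(1) _ assms(2)] someI[of "has_weak_deriv \<Omega> \<alpha> f", OF assms(2)]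
  unfolding weak_deriv_def by blast

lemma borel_measurable_lebesgue_cong_AE:
  fixes f :: "'a::euclidean_space \<Rightarrow> real"
  assumes f: "f \<in> borel_measurable lebesgue" and ae: "AE X in lebesgue. f X = g X"
  shows "g \<in> borel_measurable lebesgue"
proof (rule measurableI)
  fix A :: "real set" assume "A \<in> sets borel"
  then have "f -` A \<inter> space lebesgue \<in> sets lebesgue" using f by measurable
  moreover have "AE X in lebesgue. X \<in> f -` A \<inter> space lebesgue \<longleftrightarrow> X \<in> g -` A \<inter> space lebesgue"
    using ae by eventually_elim auto
  ultimately show "g -` A \<inter> space lebesgue \<in> sets lebesgue"
    using completion.in_sets_AE by blast
qed simp

text \<open>The chosen representative need not be continuous, but it is measurable because the Lebesgue
measure is complete.\<close>

lemma weak_deriv_powr_integral: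
  assumes "open \<Omega>" "has_weak_deriv \<Omega> \<alpha> f g" and cont: "continuous_on \<Omega> g"
  shows "(LINT X:\<Omega>|lebesgue. \<bar>weak_deriv \<Omega> \<alpha> f X\<bar> powr p) = (LINT X:\<Omega>|lebesgue. \<bar>g X\<bar> powr p)"
proof -
  have ae: "AE X in lebesgue. indicator \<Omega> X * g X = indicator \<Omega> X * weak_deriv \<Omega> \<alpha> f X"
    using weak_deriv_AE[OF assms(1,2)] by eventually_elim (auto simp: indicator_def)
  have m1[measurable]: "(\<lambda>X. indicator \<Omega> X * g X) \<in> borel_measurable lebesgue"
    using borel_measurable_continuous_on_indicator[OF _ cont] \<open>open \<Omega>\<close>
    by (intro measurable_completion) simp
  have m2[measurable]: "(\<lambda>X. indicator \<Omega> X * weak_deriv \<Omega> \<alpha> f X) \<in> borel_measurable lebesgue"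
    by (rule borel_measurable_lebesgue_cong_AE[OF m1 ae])
  have [measurable]: "\<Omega> \<in> sets lebesgue" using \<open>open \<Omega>\<close> by simp
  have "(LINT X:\<Omega>|lebesgue. \<bar>h X\<bar> powr p) = (LINT X:\<Omega>|lebesgue. \<bar>indicator \<Omega> X * h X\<bar> powr p)"
    for h :: "point \<Rightarrow> real"
    by (rule set_lebesgue_integral_cong) auto
  moreover have "(LINT X:\<Omega>|lebesgue. \<bar>indicator \<Omega> X * weak_deriv \<Omega> \<alpha> f X\<bar> powr p) =
      (LINT X:\<Omega>|lebesgue. \<bar>indicator \<Omega> X * g X\<bar> powr p)"
    using ae by (intro set_lebesgue_integral_cong_AE) (auto elim: eventually_mono)
  ultimately show ?thesis by metis
qed

section \<open>Classical derivatives are weak derivatives\<close>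

text \<open>The integral of a difference quotient \<open>(h (X + c b) - h X) / c\<close> vanishes by translation invariance
of the Lebesgue measure. By the mean value theorem the difference quotients are bounded uniformly
and supported in a common ball, so the limit \<open>c \<rightarrow> 0\<close> may be taken under the integral.\<close>

lemma integral_directional_derivative_eq_0:
  fixes h :: "'a::euclidean_space \<Rightarrow> real"
  assumes der: "\<And>X. (h has_derivative h' X) (at X)"
    and cont: "continuous_on UNIV (\<lambda>X. h' X b)"
    and "bounded S" and supp: "\<And>X. X \<notin> S \<Longrightarrow> h X = 0"
  shows "(LINT X|lborel. h' X b) = 0"
proof -
  obtain r where r: "S \<subseteq> cball 0 r" using bounded_subset_ballD[OF \<open>bounded S\<close>, of 0] ball_subset_cball by blast
  have conth: "continuous_on UNIV h"
    using der by (meson differentiableI differentiable_imp_continuous_on differentiable_at_imp_differentiable_on)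
  have [measurable]: "h \<in> borel_measurable borel" "(\<lambda>X. h' X b) \<in> borel_measurable borel"
    using conth cont by (auto intro: borel_measurable_continuous_onI)
  have inth: "integrable lborel h"
  proof -
    have "integrable lborel (\<lambda>X. indicator (cball 0 r) X *\<^sub>R h X)"
      by (rule borel_integrable_compact) (auto intro: continuous_on_subset[OF conth])
    also have "(\<lambda>X. indicator (cball 0 r) X *\<^sub>R h X) = h"
      using supp r by (force simp: indicator_def)
    finally show ?thesis .
  qed
  define c where "c n = 1 / real (Suc n)" for n
  have c: "0 < c n" "c n \<le> 1" for n by (auto simp: c_def)
  define q where "q n X = (h (X + c n *\<^sub>R b) - h X) / c n" for n X
  obtain M where M: "\<And>X. X \<in> cball 0 (r + 2 * norm b) \<Longrightarrow> \<bar>h' X b\<bar> \<le> M"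
  proof -
    have "bounded ((\<lambda>X. h' X b) ` cball 0 (r + 2 * norm b))"
      by (intro compact_imp_bounded compact_continuous_image continuous_on_subset[OF cont]) auto
    then obtain M where "\<forall>x\<in>(\<lambda>X. h' X b) ` cball 0 (r + 2 * norm b). norm x \<le> M"
      unfolding bounded_iff by blast
    then show ?thesis by (intro that[of M]) simp
  qed
  have line: "((\<lambda>\<tau>. h (X + \<tau> *\<^sub>R b)) has_real_derivative h' (X + \<tau> *\<^sub>R b) b) (at \<tau>)" for X \<tau>
  proof -
    have "((\<lambda>\<tau>. X + \<tau> *\<^sub>R b) has_derivative (\<lambda>\<tau>. \<tau> *\<^sub>R b)) (at \<tau>)"
      by (auto intro!: derivative_eq_intros)
    from has_derivative_compose[OF this der]
    have "((\<lambda>\<tau>. h (X + \<tau> *\<^sub>R b)) has_derivative (\<lambda>\<delta>. h' (X + \<tau> *\<^sub>R b) (\<delta> *\<^sub>R b))) (at \<tau>)" .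
    then show ?thesis
      using linear_scale[OF has_derivative_linear[OF der]]
      by (simp add: has_field_derivative_def mult_commute_abs)
  qed
  have int_q: "(LINT X|lborel. q n X) = 0" for n
  proof -
    have "integrable lborel (\<lambda>X. h (c n *\<^sub>R b + X))" "(LINT X|lborel. h (c n *\<^sub>R b + X)) = (LINT X|lborel. h X)"
      using integrable_distr_eq[of "(+) (c n *\<^sub>R b)" lborel borel h]
        integral_distr[of "(+) (c n *\<^sub>R b)" lborel borel h] inth
      by (auto simp: lborel_distr_plus)
    then show ?thesis using inth unfolding q_def by (simp add: add.commute)
  qed
  have "(\<lambda>n. LINT X|lborel. q n X) \<longlonglongrightarrow> (LINT X|lborel. h' X b)"
  proof (rule integral_dominated_convergence)
    show "integrable lborel (\<lambda>X. indicator (cball 0 (r + norm b)) X *\<^sub>R M)"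
      by (rule borel_integrable_compact) auto
    show "AE X in lborel. (\<lambda>n. q n X) \<longlonglongrightarrow> h' X b"
    proof (intro always_eventually allI)
      fix X
      have "((\<lambda>\<tau>. (h (X + \<tau> *\<^sub>R b) - h X) / \<tau>) \<longlongrightarrow> h' X b) (at 0)"
        using line[of X 0] by (simp add: has_field_derivative_iff)
      moreover have "filterlim c (at 0) sequentially"
        using c(1) LIMSEQ_Suc[OF lim_1_over_n[where 'a = real]] unfolding c_def
        by (auto simp: filterlim_at intro!: always_eventually)
      ultimately show "(\<lambda>n. q n X) \<longlonglongrightarrow> h' X b"
        unfolding q_def by (rule filterlim_compose)
    qed
    show "AE X in lborel. norm (q n X) \<le> indicator (cball 0 (r + norm b)) X *\<^sub>R M" for n
    proof (intro always_eventually allI)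
      fix X
      have cb: "c n * norm b \<le> norm b" using c[of n] by (simp add: mult_left_le_one_le)
      show "norm (q n X) \<le> indicator (cball 0 (r + norm b)) X *\<^sub>R M"
      proof (cases "X \<in> cball 0 (r + norm b)")
        case True
        obtain \<xi> where \<xi>: "0 < \<xi>" "\<xi> < c n" "h (X + c n *\<^sub>R b) - h (X + 0 *\<^sub>R b) = (c n - 0) * h' (X + \<xi> *\<^sub>R b) b"
          using MVT2[OF c(1)[of n] line[of X]] by blast
        have "\<xi> * norm b \<le> norm b" using \<xi> c[of n] by (simp add: mult_left_le_one_le)
        then have "X + \<xi> *\<^sub>R b \<in> cball 0 (r + 2 * norm b)"
          using True \<xi>(1) norm_triangle_ineq[of X "\<xi> *\<^sub>R b"] by simp
        moreover have "q n X = h' (X + \<xi> *\<^sub>R b) b"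
          using \<xi> c(1)[of n] by (simp add: q_def)
        ultimately show ?thesis using M True by simp
      next
        case False
        have "X \<notin> cball 0 r" "X + c n *\<^sub>R b \<notin> cball 0 r"
          using False cb c(1)[of n] norm_triangle_ineq4[of "X + c n *\<^sub>R b" "c n *\<^sub>R b"] norm_ge_zero[of b]
          by (auto simp del: norm_ge_zero)
        then have "h X = 0" "h (X + c n *\<^sub>R b) = 0" using supp r by blast+
        then have "q n X = 0" by (simp add: q_def)
        then show ?thesis using False by simp
      qed
    qed
  qed (auto simp: q_def)
  then show ?thesis unfolding int_q by (simp add: LIMSEQ_const_iff)
qed

lemma test_function_differentiable:
  assumes "test_function \<Omega> \<phi>"
  shows "(\<phi> has_derivative frechet_derivative \<phi> (at X)) (at X)"
  using assms unfolding test_function_def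
  by (metis C_k.simps(2) frechet_derivative_works)

lemma partial_outside_support:
  assumes X: "X \<notin> closure {X. \<phi> X \<noteq> 0}"
  shows "partial b \<phi> X = 0"
proof -
  have "(\<phi> has_derivative (\<lambda>v. 0)) (at X)"
  proof (rule has_derivative_transform_within_open[OF has_derivative_const])
    show "X \<in> - closure {X. \<phi> X \<noteq> 0}" using X by simp
    show "0 = \<phi> Y" if "Y \<in> - closure {X. \<phi> X \<noteq> 0}" for Y
      using that closure_subset[of "{X. \<phi> X \<noteq> 0}"] by auto
  qed auto
  then have "frechet_derivative \<phi> (at X) = (\<lambda>v. 0)" by (rule frechet_derivative_at[symmetric])
  then show ?thesis by (simp add: partial_def)
qed

lemma test_function_partial:
  assumes \<phi>: "test_function \<Omega> \<phi>" and "b \<in> Basis"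
  shows "test_function \<Omega> (partial b \<phi>)"
proof -
  have "C_k k (partial b \<phi>)" for k
    using assms unfolding test_function_def partial_def[abs_def] by (metis C_k.simps(2))
  moreover have "{X. partial b \<phi> X \<noteq> 0} \<subseteq> closure {X. \<phi> X \<noteq> 0}"
    using partial_outside_support by blast
  then have "closure {X. partial b \<phi> X \<noteq> 0} \<subseteq> closure {X. \<phi> X \<noteq> 0}"
    by (simp add: closure_minimal)
  ultimately show ?thesis
    using \<phi> unfolding test_function_def
    by (meson closed_closure compact_Int_closed closed_subset compact_closure bounded_subset compact_imp_bounded closure_subset order_trans)
qed

lemma continuous_imp_locally_integrable:
  assumes "continuous_on \<Omega> f"
  shows "locally_integrable \<Omega> f"
  unfolding locally_integrable_def set_integrable_def
  using assms borel_integrable_compact continuous_on_subset integrable_completion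
    borel_measurable_integrable by metis

text \<open>Integration by parts: \<open>f \<phi>\<close>, extended by 0 outside \<open>\<Omega>\<close>, is continuously differentiable on the whole plane in
the direction \<open>b\<close>, because \<open>\<phi>\<close> vanishes near the boundary of \<open>\<Omega>\<close>. So only the behaviour of
\<open>f\<close> inside \<open>\<Omega>\<close> matters, which is essential for the interpolation error: it has no useful values
outside the quadrilateral.\<close>

lemma has_weak_deriv_classical:
  assumes "open \<Omega>" and b: "b \<in> Basis" and D: "\<And>\<phi>. D \<alpha> \<phi> = partial b \<phi>" "fst \<alpha> + snd \<alpha> = 1"
    and der: "\<And>X. X \<in> \<Omega> \<Longrightarrow> (f has_derivative f' X) (at X)"
    and g: "\<And>X. X \<in> \<Omega> \<Longrightarrow> f' X b = g X" and cont: "continuous_on \<Omega> g"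
  shows "has_weak_deriv \<Omega> \<alpha> f g"
  unfolding has_weak_deriv_def
proof (intro conjI allI impI)
  have contf: "continuous_on \<Omega> f"
    using der by (meson differentiableI differentiable_imp_continuous_on differentiable_at_imp_differentiable_on)
  show "locally_integrable \<Omega> f" "locally_integrable \<Omega> g"
    using contf cont by (auto intro: continuous_imp_locally_integrable)
  fix \<phi> assume \<phi>: "test_function \<Omega> \<phi>"
  define S where "S = closure {X. \<phi> X \<noteq> 0}"
  have S: "compact S" "S \<subseteq> \<Omega>" using \<phi> by (auto simp: test_function_def S_def)
  have out: "\<phi> X = 0" "partial b \<phi> X = 0" if "X \<notin> S" for X
    using that closure_subset[of "{X. \<phi> X \<noteq> 0}"] partial_outside_support by (auto simp: S_def)
  have cont\<phi>: "continuous_on UNIV \<phi>" "continuous_on UNIV (partial b \<phi>)"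
    using \<phi> test_function_partial[OF \<phi> b] unfolding test_function_def by (metis C_k.simps(1))+
  \<comment> \<open>The product \<open>f \<phi>\<close> and its derivative. They are continuous on the open set \<open>\<Omega>\<close> and vanish on the
    open complement of the support \<open>S\<close>, and these two sets cover the plane.\<close>
  define h where "h X = (if X \<in> \<Omega> then f X * \<phi> X else 0)" for X
  define h' where "h' X v = (if X \<in> \<Omega> then f X * frechet_derivative \<phi> (at X) v + f' X v * \<phi> X else 0)" for X v
  have derh: "(h has_derivative h' X) (at X)" for X
  proof (cases "X \<in> \<Omega>")
    case True
    have "((\<lambda>X. f X * \<phi> X) has_derivative h' X) (at X)"
      using has_derivative_mult[OF der[OF True] test_function_differentiable[OF \<phi>, of X]] True
      by (simp add: h'_def[abs_def])
    then show ?thesis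
      by (rule has_derivative_transform_within_open[OF _ \<open>open \<Omega>\<close> True]) (simp add: h_def)
  next
    case False
    then have *: "h' X = (\<lambda>v. 0)" by (auto simp: h'_def)
    show ?thesis unfolding *
    proof (rule has_derivative_transform_within_open[OF has_derivative_const])
      show "open (- S)" by (simp add: S_def open_Compl)
    qed (use False S out in \<open>auto simp: h_def\<close>)
  qed
  have eqh': "h' X b = indicator S X *\<^sub>R (f X * partial b \<phi> X) + indicator S X *\<^sub>R (g X * \<phi> X)" for X
    using out[of X] S(2) g[of X] by (auto simp: h'_def partial_def indicator_def)
  have conth': "continuous_on UNIV (\<lambda>X. h' X b)"
  proof -
    have "continuous_on (\<Omega> \<union> - S) (\<lambda>X. h' X b)"
    proof (rule continuous_on_open_Un[OF \<open>open \<Omega>\<close>])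
      show "open (- S)" by (simp add: S_def open_Compl)
      have "continuous_on \<Omega> (\<lambda>X. f X * partial b \<phi> X + g X * \<phi> X)"
        by (intro continuous_intros contf cont continuous_on_subset[OF cont\<phi>(1)] continuous_on_subset[OF cont\<phi>(2)]) auto
      then show "continuous_on \<Omega> (\<lambda>X. h' X b)"
        by (rule continuous_on_eq) (simp add: h'_def partial_def g)
      show "continuous_on (- S) (\<lambda>X. h' X b)"
        by (rule continuous_on_eq[OF continuous_on_const[of _ 0]]) (simp add: eqh')
    qed
    moreover have "\<Omega> \<union> - S = UNIV" using S by auto
    ultimately show ?thesis by simp
  qed
  have int1: "integrable lborel (\<lambda>X. indicator S X *\<^sub>R (f X * partial b \<phi> X))"
    using S by (intro borel_integrable_compact continuous_intros continuous_on_subset[OF contf]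
      continuous_on_subset[OF cont\<phi>(2)]) auto
  have int2: "integrable lborel (\<lambda>X. indicator S X *\<^sub>R (g X * \<phi> X))"
    using S by (intro borel_integrable_compact continuous_intros continuous_on_subset[OF cont]
      continuous_on_subset[OF cont\<phi>(1)]) auto
  have "(LINT X|lborel. h' X b) = 0"
    by (rule integral_directional_derivative_eq_0[OF derh conth' compact_imp_bounded[OF S(1)]])
       (auto simp: h_def out)
  then have sum0: "(LINT X|lborel. indicator S X *\<^sub>R (f X * partial b \<phi> X)) +
      (LINT X|lborel. indicator S X *\<^sub>R (g X * \<phi> X)) = 0"
    unfolding eqh' using int1 int2 by simp
  have to_S: "(LINT X:\<Omega>|lebesgue. k X) = (LINT X|lborel. indicator S X *\<^sub>R k X)"
    if "integrable lborel (\<lambda>X. indicator S X *\<^sub>R k X)" "\<And>X. X \<notin> S \<Longrightarrow> k X = 0" for k :: "point \<Rightarrow> real"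
  proof -
    have "(LINT X:\<Omega>|lebesgue. k X) = (LINT X|lebesgue. indicator S X *\<^sub>R k X)"
      unfolding set_lebesgue_integral_def using S(2) that(2)
      by (intro Bochner_Integration.integral_cong) (auto simp: indicator_def)
    also have "\<dots> = (LINT X|lborel. indicator S X *\<^sub>R k X)"
      by (rule integral_completion[OF borel_measurable_integrable[OF that(1)]])
    finally show ?thesis .
  qed
  show "(LINT X:\<Omega>|lebesgue. f X * D \<alpha> \<phi> X) =
      (- 1) ^ (fst \<alpha> + snd \<alpha>) * (LINT X:\<Omega>|lebesgue. g X * \<phi> X)"
    using sum0 out by (simp add: D to_S[OF int1] to_S[OF int2])
qed

lemma has_weak_deriv_x:
  assumes "open \<Omega>" "\<And>X. X \<in> \<Omega> \<Longrightarrow> (f has_derivative f' X) (at X)"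
    and "\<And>X. X \<in> \<Omega> \<Longrightarrow> f' X (1, 0) = g X" "continuous_on \<Omega> g"
  shows "has_weak_deriv \<Omega> (1, 0) f g"
  by (rule has_weak_deriv_classical[where b = "(1, 0)" and f' = f'])
    (use assms in \<open>simp_all add: D_def Basis_prod_def\<close>)

lemma has_weak_deriv_y:
  assumes "open \<Omega>" "\<And>X. X \<in> \<Omega> \<Longrightarrow> (f has_derivative f' X) (at X)"
    and "\<And>X. X \<in> \<Omega> \<Longrightarrow> f' X (0, 1) = g X" "continuous_on \<Omega> g"
  shows "has_weak_deriv \<Omega> (0, 1) f g"
  by (rule has_weak_deriv_classical[where b = "(0, 1)" and f' = f'])
    (use assms in \<open>simp_all add: D_def Basis_prod_def\<close>)

text \<open>\<open>D\<close> applies the derivatives in the second coordinate first; this is why the second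
coordinate is only split off when no derivative in the first one is left.\<close>

lemma D_Suc_x: "D (Suc i, j) \<phi> = partial (1, 0) (D (i, j) \<phi>)"
  and D_Suc_y: "D (0, Suc j) \<phi> = partial (0, 1) (D (0, j) \<phi>)"
  by (simp_all add: D_def)

lemma test_function_D:
  assumes "test_function \<Omega> \<phi>"
  shows "test_function \<Omega> (D (i, j) \<phi>)"
proof (induction i)
  case 0
  show ?case
  proof (induction j)
    case 0
    then show ?case using assms by (simp add: D_def)
  next
    case (Suc j)
    then show ?case unfolding D_Suc_y by (rule test_function_partial) (simp add: Basis_prod_def)
  qed
next
  case (Suc i)
  then show ?case unfolding D_Suc_x by (rule test_function_partial) (simp add: Basis_prod_def)
qed

lemma has_weak_deriv_Suc_x:
  assumes f: "has_weak_deriv \<Omega> (1, 0) f f1" and f1: "has_weak_deriv \<Omega> (i, j) f1 g"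
  shows "has_weak_deriv \<Omega> (Suc i, j) f g"
  unfolding has_weak_deriv_def
proof (intro conjI allI impI)
  show "locally_integrable \<Omega> f" "locally_integrable \<Omega> g"
    using f f1 by (simp_all add: has_weak_deriv_def)
  fix \<phi> assume \<phi>: "test_function \<Omega> \<phi>"
  show "(LINT X:\<Omega>|lebesgue. f X * D (Suc i, j) \<phi> X) =
      (- 1) ^ (fst (Suc i, j) + snd (Suc i, j)) * (LINT X:\<Omega>|lebesgue. g X * \<phi> X)"
    using has_weak_derivD[OF f test_function_D[OF \<phi>, of i j]]
      has_weak_derivD[OF f1 \<phi>]
    by (simp add: D_Suc_x D_Suc_x[of 0 0, simplified] D_def[of "(0,0)"])
qed

lemma has_weak_deriv_Suc_y:
  assumes f: "has_weak_deriv \<Omega> (0, 1) f f1" and f1: "has_weak_deriv \<Omega> (0, j) f1 g"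
  shows "has_weak_deriv \<Omega> (0, Suc j) f g"
  unfolding has_weak_deriv_def
proof (intro conjI allI impI)
  show "locally_integrable \<Omega> f" "locally_integrable \<Omega> g"
    using f f1 by (simp_all add: has_weak_deriv_def)
  fix \<phi> assume \<phi>: "test_function \<Omega> \<phi>"
  show "(LINT X:\<Omega>|lebesgue. f X * D (0, Suc j) \<phi> X) =
      (- 1) ^ (fst (0, Suc j) + snd (0, Suc j)) * (LINT X:\<Omega>|lebesgue. g X * \<phi> X)"
    using has_weak_derivD[OF f test_function_D[OF \<phi>, of 0 j]]
      has_weak_derivD[OF f1 \<phi>]
    by (simp add: D_Suc_y D_Suc_y[of 0, simplified] D_def[of "(0,0)"])
qed

lemma has_weak_deriv_poly_fst:
  assumes "open \<Omega>"
  shows "has_weak_deriv \<Omega> (i, j) (\<lambda>X. poly q (fst X))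
    (\<lambda>X. poly (if j = 0 then (pderiv ^^ i) q else 0) (fst X))"
proof -
  have der: "((\<lambda>X. poly q (fst X)) has_derivative (\<lambda>v. fst v * poly (pderiv q) (fst X))) (at X)"
    for q :: "real poly" and X :: point
    by (rule DERIV_compose_FDERIV[OF poly_DERIV]) (auto intro!: derivative_eq_intros)
  have x: "has_weak_deriv \<Omega> (1, 0) (\<lambda>X. poly q (fst X)) (\<lambda>X. poly (pderiv q) (fst X))" for q
    by (rule has_weak_deriv_x[OF assms der[of q]]) (auto intro!: continuous_intros)
  have y: "has_weak_deriv \<Omega> (0, 1) (\<lambda>X. poly q (fst X)) (\<lambda>X. poly 0 (fst X))" for q
    by (rule has_weak_deriv_y[OF assms der[of q]]) (auto intro!: continuous_intros)
  show ?thesis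
  proof (induction i arbitrary: q)
    case 0
    show ?case
    proof (induction j arbitrary: q)
      case 0
      have "locally_integrable \<Omega> (\<lambda>X. poly q (fst X))"
        by (intro continuous_imp_locally_integrable continuous_intros)
      then show ?case by (simp add: has_weak_deriv_def D_def)
    next
      case (Suc j)
      show ?case using has_weak_deriv_Suc_y[OF y Suc[of 0]] by (simp cong: if_cong)
    qed
  next
    case (Suc i)
    show ?case
      using has_weak_deriv_Suc_x[OF x Suc[of "pderiv q"]] by (cases "j = 0") (simp_all add: funpow_swap1)
  qed
qed

section \<open>The angles\<close>

text \<open>The second disjunct, together with a negative inner product, says that the cosine is at least
\<open>- 1/\<surd>2\<close>; squaring avoids the norms.\<close>

lemma vertex_angle_le:
  assumes "0 \<le> (A - B) \<bullet> (C - B) \<or> 2 * ((A - B) \<bullet> (C - B))\<^sup>2 \<le> ((A - B) \<bullet> (A - B)) * ((C - B) \<bullet> (C - B))"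
  shows "vertex_angle A B C \<le> 3 * pi / 4"
proof -
  define d N where "d = (A - B) \<bullet> (C - B)" and "N = norm (A - B) * norm (C - B)"
  have N: "0 \<le> N" "N\<^sup>2 = ((A - B) \<bullet> (A - B)) * ((C - B) \<bullet> (C - B))"
    by (simp_all add: N_def power_mult_distrib power2_norm_eq_inner)
  have dN: "\<bar>d\<bar> \<le> N" unfolding d_def N_def by (rule Cauchy_Schwarz_ineq2)
  have "- (sqrt 2 / 2) * N \<le> d"
  proof (cases "0 \<le> d")
    case True
    moreover have "- (sqrt 2 / 2) * N \<le> 0" using N by simp
    ultimately show ?thesis by linarith
  next
    case False
    then have "2 * d\<^sup>2 \<le> N\<^sup>2" using assms N(2) by (simp add: d_def)
    then have "(- d)\<^sup>2 \<le> (sqrt 2 / 2 * N)\<^sup>2" by (simp add: power_mult_distrib power_divide)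
    then have "- d \<le> sqrt 2 / 2 * N" using N(1) by (simp add: power2_le_iff_abs_le)
    then show ?thesis by simp
  qed
  then have lower: "- (sqrt 2 / 2) \<le> d / N" if "N > 0" using that by (simp add: pos_le_divide_eq)
  have lower': "- (sqrt 2 / 2) \<le> d / N" using lower N(1) by (cases "N = 0") auto
  have "cos (3 * pi / 4) = - (sqrt 2 / 2)"
    using cos_pi_minus[of "pi / 4"] cos_45 by (simp add: field_simps)
  moreover have "\<bar>d / N\<bar> \<le> 1" using dN N(1) by (auto simp: abs_divide divide_le_eq)
  ultimately have "arccos (d / N) \<le> arccos (cos (3 * pi / 4))"
    using lower' sqrt2_less_2 abs_le_D1[of "d / N" 1] by (intro arccos_le_arccos) simp_all
  also have "\<dots> = 3 * pi / 4" by (rule arccos_cos) auto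
  finally show ?thesis by (simp add: vertex_angle_def d_def N_def)
qed

context
  fixes s :: real
  assumes s: "0 < s" "s < 1 / 2"
begin

lemma K_quad_convex: "convex_quad (K_quad 1 s s (2 * s))"
  using s by (auto simp: convex_quad_def K_quad_def left_turn_def)

lemma K_quad_angle_V3: "vertex_angle (1, 0) (s, 2 * s) (0, s) \<le> 3 * pi / 4"
proof -
  have "s ^ 4 \<le> s ^ 3" using s by (intro power_decreasing) auto
  then show ?thesis
    by (intro vertex_angle_le disjI2) (simp add: power2_eq_square power3_eq_cube power4_eq_xxxx algebra_simps)
qed

lemma K_quad_MAC: "MAC (3 * pi / 4) (K_quad 1 s s (2 * s))"
proof -
  have "vertex_angle (0, s) (0, 0) (1, 0) \<le> 3 * pi / 4"
    "vertex_angle (0, 0) (1, 0) (s, 2 * s) \<le> 3 * pi / 4"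
    by (rule vertex_angle_le; use s in simp)+
  moreover have "vertex_angle (s, 2 * s) (0, s) (0, 0) \<le> 3 * pi / 4"
    by (intro vertex_angle_le disjI2) (simp add: power2_eq_square algebra_simps)
  ultimately show ?thesis
    using K_quad_angle_V3 by (simp add: MAC_def quad_angles_def K_quad_def)
qed

text \<open>The dividing diagonal is the long one, from \<open>(1, 0)\<close> to \<open>(0, s)\<close>; the other one has length
\<open>s \<surd>5\<close>, and the first one is longer than \<open>s\<close>.\<close>

lemma K_quad_RDP: "RDP (sqrt 5) (3 * pi / 4) (K_quad 1 s s (2 * s))"
proof -
  have "vertex_angle (0, s) (0, 0) (1, 0) \<le> 3 * pi / 4"
    "vertex_angle (0, 0) (1, 0) (0, s) \<le> 3 * pi / 4"
    "vertex_angle (1, 0) (0, s) (0, 0) \<le> 3 * pi / 4"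
    "vertex_angle (0, s) (1, 0) (s, 2 * s) \<le> 3 * pi / 4"
    by (rule vertex_angle_le; use s in simp)+
  moreover have "vertex_angle (s, 2 * s) (0, s) (1, 0) \<le> 3 * pi / 4"
  proof -
    have "s * s \<le> s" using s by (simp add: mult_left_le)
    then show ?thesis by (intro vertex_angle_le disjI1) simp
  qed
  moreover have "dist (0::real, 0::real) (s, 2 * s) / dist (1::real, 0) (0, s) \<le> sqrt 5"
  proof -
    have "dist (0::real, 0::real) (s, 2 * s) = sqrt 5 * s"
      using s by (simp add: dist_Pair_Pair dist_real_def power_mult_distrib real_sqrt_mult)
    moreover have "s \<le> dist (1::real, 0) (0, s)"
      using s dist_snd_le[of "(1::real, 0::real)" "(0, s)"] by (simp add: dist_real_def)
    ultimately show ?thesis using s by (simp add: divide_le_eq mult_left_mono)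
  qed
  ultimately show ?thesis
    using K_quad_angle_V3 by (simp add: RDP_def triangle_angles_def K_quad_def)
qed

end

text \<open>The angle at \<open>(1, 0)\<close> has cosine at least \<open>(1 - s)/(1 + s) \<ge> 1 - 2 s\<close>, which exceeds
\<open>cos \<psi>\<close> for small \<open>s\<close>.\<close>

lemma K_quad_not_mac:
  assumes "\<psi> > 0" and mac: "\<And>s. 0 < s \<Longrightarrow> s < 1/2 \<Longrightarrow> mac \<psi> (K_quad 1 s s (2 * s))"
  shows False
proof -
  have bound: "1 - 2 * s \<le> cos \<psi> \<and> \<psi> \<le> pi" if s: "0 < s" "s < 1/2" for s
  proof -
    define d N :: real where "d = ((0, 0) - (1, 0)) \<bullet> ((s, 2 * s) - (1, 0))"
      and "N = norm ((0, 0) - (1::real, 0::real)) * norm ((s, 2 * s) - (1, 0))"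
    have d: "d = 1 - s" by (simp add: d_def)
    have "N = norm ((s - 1, 2 * s))" by (simp add: N_def norm_Pair)
    also have "\<dots> \<le> 1 + s" using norm_Pair_le[of "s - 1" "2 * s"] s by simp
    finally have N: "N \<le> 1 + s" .
    have dN: "\<bar>d\<bar> \<le> N" unfolding d_def N_def by (rule Cauchy_Schwarz_ineq2)
    then have dN1: "\<bar>d / N\<bar> \<le> 1" and "0 < N" using d s by (auto simp: abs_divide divide_le_eq)
    have rng: "- 1 \<le> d / N" "d / N \<le> 1"
      using abs_le_D1[OF dN1] abs_le_D2[OF dN1] by linarith+
    have "(1 - 2 * s) * N \<le> (1 - 2 * s) * (1 + s)" using N s by (intro mult_left_mono) auto
    also have "\<dots> \<le> d" using s by (simp add: d algebra_simps)
    finally have 1: "1 - 2 * s \<le> d / N" using \<open>0 < N\<close> by (simp add: pos_le_divide_eq)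
    have "\<psi> \<le> arccos (d / N)"
      using mac[OF s] by (simp add: mac_def quad_angles_def K_quad_def vertex_angle_def d_def N_def)
    moreover have "arccos (d / N) \<le> pi" using rng by (rule arccos_ubound)
    ultimately have "cos (arccos (d / N)) \<le> cos \<psi>" "\<psi> \<le> pi"
      using \<open>\<psi> > 0\<close> by (auto intro!: cos_monotone_0_pi_le)
    moreover have "cos (arccos (d / N)) = d / N" using rng by (rule cos_arccos)
    ultimately show ?thesis using 1 by linarith
  qed
  have "\<psi> \<le> pi" using bound[of "1/4"] by simp
  then have "cos \<psi> < 1" using \<open>\<psi> > 0\<close> cos_monotone_0_pi[of 0 \<psi>] by simp
  then have "0 < (1 - cos \<psi>) / 5" by simp
  moreover have "(1 - cos \<psi>) / 5 < 1/2"
    using cos_ge_minus_one[of \<psi>] unfolding pos_divide_less_eq[OF zero_less_numeral] by argo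
  ultimately have "1 - 2 * ((1 - cos \<psi>) / 5) \<le> cos \<psi>" using bound by blast
  with \<open>cos \<psi> < 1\<close> show False by argo
qed

section \<open>The interpolation error in inverse coordinates\<close>

text \<open>The Jacobian determinant of \<open>F\<close> is \<open>s\<close> times \<open>1 + x - t y\<close>. The latter is the
difference of the numbers \<open>1 + x\<close> and \<open>t y\<close>, whose sum is \<open>1 + X + m\<close> and whose product is
\<open>m\<close>; so its square is the discriminant below.\<close>

definition jac :: "real \<Rightarrow> real \<Rightarrow> real" where
  "jac X m = sqrt ((1 + X + m)\<^sup>2 - 4 * m)"

text \<open>The reference coordinates \<open>x\<close> and \<open>t y\<close> of the point \<open>(X, Y)\<close> with \<open>m = t Y / s\<close>.\<close>

definition xhat :: "real \<Rightarrow> real \<Rightarrow> real" where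
  "xhat X m = (X + m - 1 + jac X m) / 2"

definition tyhat :: "real \<Rightarrow> real \<Rightarrow> real" where
  "tyhat X m = (1 + X + m - jac X m) / 2"

definition cubic :: "real \<Rightarrow> real" where
  "cubic x = x * (x - 1/2) * (x - 1)"

text \<open>The quadratic interpolant of \<open>x\<^sup>3\<close> at \<open>0, 1/2, 1\<close>; the interpolation error \<open>x\<^sup>3 - cubic_interp x\<close>
is \<open>cubic x\<close>.\<close>

definition cubic_interp :: "real \<Rightarrow> real" where
  "cubic_interp x = (3 * x\<^sup>2 - x) / 2"

text \<open>The error \<open>u - Q\<^sub>2 u\<close> at the point with reference coordinates \<open>a = x\<close> and \<open>b = t y\<close>. The first
term is the error of interpolating \<open>x\<^sup>3 (1 - t y)\<^sup>3\<close> in \<open>x\<close>, the second that of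
interpolating the factor \<open>(1 - t y)\<^sup>3\<close> in \<open>y\<close> afterwards; the lower powers in \<open>u \<circ> F\<close> are
interpolated exactly.\<close>

definition err_hat :: "real \<Rightarrow> real \<Rightarrow> real \<Rightarrow> real" where
  "err_hat t a b = (1 - b) ^ 3 * cubic a - cubic_interp a * (b * (b - t / 2) * (b - t))"

text \<open>The derivative of the error in \<open>m\<close>. It arises from the chain rule and the identities
\<open>\<partial>x/\<partial>m = x / jac\<close> and \<open>\<partial>(t y)/\<partial>m = (1 - t y) / jac\<close>.\<close>

definition err_hat_m :: "real \<Rightarrow> real \<Rightarrow> real \<Rightarrow> real" where
  "err_hat_m t X m = (let a = xhat X m; b = tyhat X m in
     (a * ((1 - b) ^ 3 * (3 * a\<^sup>2 - 3 * a + 1/2) - (3 * a - 1/2) * (b * (b - t / 2) * (b - t)))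
      + (1 - b) * (- 3 * (1 - b)\<^sup>2 * cubic a - cubic_interp a * (3 * b\<^sup>2 - 3 * t * b + t\<^sup>2 / 2))) / jac X m)"

lemma jac_pos:
  fixes X m :: real
  assumes "0 \<le> X" "0 \<le> m" "X = 0 \<Longrightarrow> m < 1"
  shows "0 < (1 + X + m)\<^sup>2 - 4 * m"
proof -
  have eq: "(1 + X + m)\<^sup>2 - 4 * m = (1 - m)\<^sup>2 + 2 * X * (1 + m) + X\<^sup>2"
    by (simp add: power2_eq_square algebra_simps)
  show ?thesis
  proof (cases "X = 0")
    case True
    then show ?thesis using assms(3) unfolding eq by simp
  next
    case False
    then have "0 < X\<^sup>2" "0 \<le> 2 * X * (1 + m)" using assms by auto
    then show ?thesis unfolding eq using zero_le_power2[of "1 - m"] by linarith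
  qed
qed

lemma xhat_tyhat:
  assumes "0 \<le> (1 + X + m)\<^sup>2 - 4 * m"
  shows "xhat X m * (1 - tyhat X m) = X" "tyhat X m * (1 + xhat X m) = m"
proof -
  have R: "(jac X m)\<^sup>2 = (1 + X + m)\<^sup>2 - 4 * m" using assms by (simp add: jac_def)
  have "4 * (tyhat X m * (1 + xhat X m)) = (1 + X + m)\<^sup>2 - (jac X m)\<^sup>2"
    unfolding xhat_def tyhat_def by (simp add: power2_eq_square field_simps)
  then show *: "tyhat X m * (1 + xhat X m) = m" unfolding R by simp
  have "xhat X m + tyhat X m = X + m" by (simp add: xhat_def tyhat_def field_simps)
  with * show "xhat X m * (1 - tyhat X m) = X" by (simp add: algebra_simps)
qed

lemma xhat_tyhat_unique:
  assumes "b \<le> 1 + a"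
  shows "xhat (a * (1 - b)) (b * (1 + a)) = a" "tyhat (a * (1 - b)) (b * (1 + a)) = b"
proof -
  have "(1 + a * (1 - b) + b * (1 + a))\<^sup>2 - 4 * (b * (1 + a)) = (1 + a - b)\<^sup>2"
    by (simp add: power2_eq_square algebra_simps)
  then have "jac (a * (1 - b)) (b * (1 + a)) = 1 + a - b"
    using assms unfolding jac_def by simp
  then show "xhat (a * (1 - b)) (b * (1 + a)) = a" "tyhat (a * (1 - b)) (b * (1 + a)) = b"
    by (simp_all add: xhat_def tyhat_def algebra_simps)
qed

lemma err_hat_has_derivative:
  fixes t \<sigma> :: real and X :: point
  assumes pos: "0 < (1 + fst X + \<sigma> * snd X)\<^sup>2 - 4 * (\<sigma> * snd X)"
  defines "E \<equiv> \<lambda>X. err_hat t (xhat (fst X) (\<sigma> * snd X)) (tyhat (fst X) (\<sigma> * snd X))"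
  shows "(E has_derivative frechet_derivative E (at X)) (at X)"
    and "frechet_derivative E (at X) (0, 1) = \<sigma> * err_hat_m t (fst X) (\<sigma> * snd X)"
proof -
  define R a b where "R = jac (fst X) (\<sigma> * snd X)" and "a = xhat (fst X) (\<sigma> * snd X)"
    and "b = tyhat (fst X) (\<sigma> * snd X)"
  have R: "R > 0" using pos by (simp add: R_def jac_def)
  define dR where "dR v = ((1 + fst X + \<sigma> * snd X) * (fst v + \<sigma> * snd v) - 2 * (\<sigma> * snd v)) / R" for v :: point
  define da where "da v = (fst v + \<sigma> * snd v + dR v) / 2" for v
  define db where "db v = (fst v + \<sigma> * snd v - dR v) / 2" for v
  have "((\<lambda>X. jac (fst X) (\<sigma> * snd X)) has_derivative dR) (at X)"
    unfolding jac_def dR_def[abs_def] R_def using pos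
    by (auto intro!: derivative_eq_intros simp: field_simps)
  note [derivative_intros] = this
  have "((\<lambda>X. xhat (fst X) (\<sigma> * snd X)) has_derivative da) (at X)"
    unfolding xhat_def da_def[abs_def] by (auto intro!: derivative_eq_intros)
  note A = this
  have "((\<lambda>X. tyhat (fst X) (\<sigma> * snd X)) has_derivative db) (at X)"
    unfolding tyhat_def db_def[abs_def] by (auto intro!: derivative_eq_intros)
  note B = this
  define Ea where "Ea = (1 - b) ^ 3 * (3 * a\<^sup>2 - 3 * a + 1/2) - (3 * a - 1/2) * (b * (b - t / 2) * (b - t))"
  define Eb where "Eb = - 3 * (1 - b)\<^sup>2 * cubic a - cubic_interp a * (3 * b\<^sup>2 - 3 * t * b + t\<^sup>2 / 2)"
  have E: "(E has_derivative (\<lambda>v. Ea * da v + Eb * db v)) (at X)"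
    unfolding E_def err_hat_def cubic_def cubic_interp_def
    by (rule has_derivative_eq_rhs, (rule derivative_eq_intros A B refl | simp)+)
       (simp add: fun_eq_iff Ea_def Eb_def a_def[symmetric] b_def[symmetric] cubic_def cubic_interp_def
         power2_eq_square power3_eq_cube field_simps)
  then have eq: "frechet_derivative E (at X) = (\<lambda>v. Ea * da v + Eb * db v)"
    by (rule frechet_derivative_at[symmetric])
  show "(E has_derivative frechet_derivative E (at X)) (at X)" unfolding eq by (rule E)
  have "da (0, 1) = \<sigma> * (a / R)" "db (0, 1) = \<sigma> * ((1 - b) / R)"
    using R unfolding da_def db_def dR_def a_def b_def xhat_def tyhat_def R_def[symmetric]
    by (simp_all add: field_simps)
  then have "frechet_derivative E (at X) (0, 1) = Ea * (\<sigma> * (a / R)) + Eb * (\<sigma> * ((1 - b) / R))"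
    unfolding eq by simp
  also have "\<dots> = \<sigma> * ((a * Ea + (1 - b) * Eb) / R)"
    using R by (simp add: field_simps)
  also have "(a * Ea + (1 - b) * Eb) / R = err_hat_m t (fst X) (\<sigma> * snd X)"
    unfolding err_hat_m_def Let_def Ea_def Eb_def a_def b_def R_def ..
  finally show "frechet_derivative E (at X) (0, 1) = \<sigma> * err_hat_m t (fst X) (\<sigma> * snd X)" .
qed

lemma continuous_on_err_hat_m:
  assumes "\<And>Z. Z \<in> S \<Longrightarrow> 0 < (1 + X Z + m Z)\<^sup>2 - 4 * m Z"
    and [continuous_intros]: "continuous_on S t" "continuous_on S X" "continuous_on S m"
  shows "continuous_on S (\<lambda>Z. err_hat_m (t Z) (X Z) (m Z))"
  unfolding err_hat_m_def Let_def xhat_def tyhat_def jac_def cubic_def cubic_interp_def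
  by (intro continuous_intros) (use assms(1) in force)+

text \<open>At \<open>t = 1\<close>, \<open>X = 1/2\<close>, \<open>m = 0\<close> the value is \<open>- 1/8\<close>; continuity in all three variables gives half
of that in a neighbourhood. The bound \<open>1/4\<close> on \<open>d\<close> keeps the neighbourhood inside all \<open>K\<^sub>s\<close>.\<close>

lemma err_hat_m_bound_near:
  obtains d where "0 < d" "d \<le> 1/4"
    "\<And>t X m. \<bar>t - 1\<bar> < d \<Longrightarrow> \<bar>X - 1/2\<bar> \<le> d \<Longrightarrow> 0 \<le> m \<Longrightarrow> m \<le> d \<Longrightarrow> 1/16 \<le> \<bar>err_hat_m t X m\<bar>"
proof -
  define S :: "(real \<times> real \<times> real) set" where "S = {Z. 0 < (1 + fst (snd Z) + snd (snd Z))\<^sup>2 - 4 * snd (snd Z)}"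
  have "open S"
    unfolding S_def by (intro open_Collect_less continuous_intros)
  have cont: "continuous_on S (\<lambda>Z. err_hat_m (fst Z) (fst (snd Z)) (snd (snd Z)))"
    by (intro continuous_on_err_hat_m continuous_intros) (auto simp: S_def)
  have mem: "(1, 1/2, 0) \<in> S" by (simp add: S_def)
  have jac: "jac (1/2) 0 = 3/2"
    unfolding jac_def by (rule real_sqrt_unique) (simp_all add: power2_eq_square)
  have val: "err_hat_m 1 (1/2) 0 = - 1/8"
    by (simp add: err_hat_m_def Let_def xhat_def tyhat_def jac cubic_def cubic_interp_def power2_eq_square)
  have "isCont (\<lambda>Z. err_hat_m (fst Z) (fst (snd Z)) (snd (snd Z))) (1, 1/2, 0)"
    using continuous_on_eq_continuous_at[OF \<open>open S\<close>] cont mem by blast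
  then obtain e where "e > 0" and e: "\<And>Z. dist Z (1, 1/2, 0) < e \<Longrightarrow>
      dist (err_hat_m (fst Z) (fst (snd Z)) (snd (snd Z))) (- 1/8) < 1/16"
    unfolding continuous_at_eps_delta by (force simp: val dest: spec[of _ "1/16"])
  define d where "d = min (1/4) (e / 4)"
  have d: "0 < d" "d \<le> 1/4" "d \<le> e / 4" using \<open>e > 0\<close> by (auto simp: d_def)
  have "1/16 \<le> \<bar>err_hat_m t X m\<bar>" if *: "\<bar>t - 1\<bar> < d" "\<bar>X - 1/2\<bar> \<le> d" "0 \<le> m" "m \<le> d" for t X m
  proof -
    have "dist (t, X, m) (1, 1/2, 0) = norm (t - 1, X - 1/2, m)" by (simp add: dist_norm)
    also have "\<dots> \<le> norm (t - 1) + norm (X - 1/2, m)" by (rule norm_Pair_le)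
    also have "\<dots> \<le> norm (t - 1) + (norm (X - 1/2) + norm m)" by (intro add_left_mono norm_Pair_le)
    also have "\<dots> < e" using * d \<open>e > 0\<close> by simp
    finally have "dist (err_hat_m t X m) (- 1/8) < 1/16" using e[of "(t, X, m)"] by simp
    then show ?thesis by (auto simp: dist_real_def abs_if split: if_splits)
  qed
  with d that show ?thesis by blast
qed

section \<open>The quadrilaterals\<close>

context
  fixes s t :: real and K :: quad
  assumes s: "0 < s" "s < 1 / 2"
  defines "t \<equiv> 1 - s" and "K \<equiv> K_quad 1 s s (2 * s)"
begin

lemma F_K: "F K (x, y) = (x * (1 - t * y), s * (y * (1 + x)))"
  by (simp add: F_def K_def K_quad_def phi1_def phi2_def phi3_def phi4_def t_def algebra_simps)

lemma F_K_inverse: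
  assumes "Z \<in> Khat"
  shows "xhat (fst (F K Z)) (t / s * snd (F K Z)) = fst Z"
    and "tyhat (fst (F K Z)) (t / s * snd (F K Z)) = t * snd Z"
proof -
  obtain x y where Z: "Z = (x, y)" by (cases Z)
  have xy: "0 \<le> x" "x \<le> 1" "0 \<le> y" "y \<le> 1" using assms by (auto simp: Z Khat_def)
  have "t * y \<le> 1" using s xy by (intro mult_le_one) (auto simp: t_def)
  then have le: "t * y \<le> 1 + x" using xy by simp
  have "t / s * snd (F K Z) = t * y * (1 + x)" using s by (simp add: Z F_K)
  then show "xhat (fst (F K Z)) (t / s * snd (F K Z)) = fst Z"
    "tyhat (fst (F K Z)) (t / s * snd (F K Z)) = t * snd Z"
    using xhat_tyhat_unique[OF le] by (simp_all add: Z F_K)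
qed

lemma inj_on_F_K: "inj_on (F K) Khat"
proof (rule inj_onI)
  fix Z Z' assume "Z \<in> Khat" "Z' \<in> Khat" "F K Z = F K Z'"
  then have "fst Z = fst Z'" "t * snd Z = t * snd Z'" using F_K_inverse by metis+
  then show "Z = Z'" using s by (simp add: prod_eq_iff t_def)
qed

text \<open>In reference coordinates the four conditions are \<open>x \<ge> 0\<close>, \<open>y \<ge> 0\<close>, \<open>x \<le> 1\<close> and \<open>y \<le> 1\<close>,
in this order.\<close>

definition half_planes :: "point set" where
  "half_planes = {X. 0 \<le> fst X \<and> 0 \<le> snd X \<and> t * snd X \<le> 2 * s * (1 - fst X) \<and> snd X \<le> s + fst X}"

text \<open>After moving the square root to one side and squaring, each of the four inequalities that define
\<open>Khat\<close> becomes one of the four half planes.\<close>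

lemma half_planes_F_K:
  assumes "Z \<in> half_planes"
  obtains W where "W \<in> Khat" "F K W = Z"
proof -
  obtain X Y where Z: "Z = (X, Y)" by (cases Z)
  define m where "m = t / s * Y"
  have t: "0 < t" "t < 1" using s by (auto simp: t_def)
  have XY: "0 \<le> X" "0 \<le> Y" "t * Y \<le> 2 * s * (1 - X)" "Y \<le> s + X"
    using assms by (auto simp: Z half_planes_def)
  have m: "0 \<le> m" "m \<le> 2 * (1 - X)" using XY s t by (auto simp: m_def field_simps)
  have mt: "m * (1 - t) \<le> t * (1 - t + X)"
  proof -
    have "m * (1 - t) = t * Y" using s by (simp add: m_def t_def)
    also have "\<dots> \<le> t * (s + X)" using XY t by (intro mult_left_mono) auto
    finally show ?thesis by (simp add: t_def)
  qed
  define \<Delta> where "\<Delta> = (1 + X + m)\<^sup>2 - 4 * m"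
  have \<Delta>: "0 \<le> \<Delta>"
  proof -
    have "\<Delta> = (1 - m)\<^sup>2 + 2 * X * (1 + m) + X\<^sup>2" by (simp add: \<Delta>_def power2_eq_square algebra_simps)
    then show ?thesis using XY m by simp
  qed
  have "0 \<le> xhat X m"
  proof -
    have "1 - X - m \<le> sqrt \<Delta>"
      by (rule real_le_rsqrt) (use XY in \<open>simp add: \<Delta>_def power2_eq_square algebra_simps\<close>)
    then show ?thesis by (simp add: xhat_def jac_def \<Delta>_def)
  qed
  moreover have "xhat X m \<le> 1"
  proof -
    have "sqrt \<Delta> \<le> 3 - X - m"
      using m XY by (intro real_le_lsqrt) (simp_all add: \<Delta>_def power2_eq_square algebra_simps)
    then show ?thesis by (simp add: xhat_def jac_def \<Delta>_def)
  qed
  moreover have "0 \<le> tyhat X m"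
  proof -
    have "sqrt \<Delta> \<le> 1 + X + m"
      using m XY by (intro real_le_lsqrt) (simp_all add: \<Delta>_def power2_eq_square algebra_simps)
    then show ?thesis by (simp add: tyhat_def jac_def \<Delta>_def)
  qed
  moreover have "tyhat X m \<le> t"
  proof -
    have "1 + X + m - 2 * t \<le> sqrt \<Delta>"
      by (rule real_le_rsqrt) (use mt in \<open>simp add: \<Delta>_def power2_eq_square algebra_simps\<close>)
    then show ?thesis by (simp add: tyhat_def jac_def \<Delta>_def)
  qed
  ultimately have "(xhat X m, tyhat X m / t) \<in> Khat" using t by (simp add: Khat_def)
  moreover have "F K (xhat X m, tyhat X m / t) = Z"
    using xhat_tyhat[OF \<Delta>[unfolded \<Delta>_def]] t s by (simp add: F_K Z m_def)
  ultimately show ?thesis by (rule that)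
qed

lemma region_K: "region K = half_planes"
proof
  have "half_planes = {X. (-1, 0) \<bullet> X \<le> 0} \<inter> {X. (0, -1) \<bullet> X \<le> 0} \<inter>
      {X. (2 * s, t) \<bullet> X \<le> 2 * s} \<inter> {X. (-1, 1) \<bullet> X \<le> s}"
    by (auto simp: half_planes_def algebra_simps)
  then have "convex half_planes" by (simp add: convex_Int convex_halfspace_le)
  then show "region K \<subseteq> half_planes"
    unfolding region_def using s
    by (intro hull_minimal) (auto simp: K_def K_quad_def half_planes_def t_def algebra_simps)
  show "half_planes \<subseteq> region K"
  proof
    fix Z assume "Z \<in> half_planes"
    then obtain x y where xy: "(x, y) \<in> Khat" and Z: "F K (x, y) = Z"
      using half_planes_F_K by (metis surj_pair)
    define V where "V = {V1 K, V2 K, V3 K, V4 K}"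
    have V: "convex (convex hull V)" "V1 K \<in> convex hull V" "V2 K \<in> convex hull V" "V3 K \<in> convex hull V" "V4 K \<in> convex hull V"
      by (auto simp: V_def intro: hull_inc)
    have "Z = (1 - y) *\<^sub>R ((1 - x) *\<^sub>R V1 K + x *\<^sub>R V2 K) + y *\<^sub>R ((1 - x) *\<^sub>R V4 K + x *\<^sub>R V3 K)"
      by (simp add: Z[symmetric] F_def phi1_def phi2_def phi3_def phi4_def algebra_simps)
    also have "\<dots> \<in> convex hull V"
      using V xy by (intro convexD[OF V(1)]) (auto simp: Khat_def)
    finally show "Z \<in> region K" by (simp add: region_def V_def)
  qed
qed

text \<open>For nonnegative \<open>X\<close> and \<open>m\<close> the discriminant vanishes only at \<open>X = 0\<close>, \<open>m = 1\<close>, that is at \<open>(0, s/t)\<close>, which lies just above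
the vertex \<open>(0, s)\<close>. Hence the error is smooth up to the boundary for each \<open>s\<close>, and the seminorm is
a genuine finite integral.\<close>

lemma region_K_jac:
  assumes "X \<in> region K"
  shows "0 < (1 + fst X + t / s * snd X)\<^sup>2 - 4 * (t / s * snd X)"
proof (rule jac_pos)
  have X: "0 \<le> fst X" "0 \<le> snd X" "snd X \<le> s + fst X"
    using assms by (auto simp: region_K half_planes_def)
  show "0 \<le> fst X" "0 \<le> t / s * snd X" using X s by (auto simp: t_def)
  assume "fst X = 0"
  then have "t / s * snd X \<le> t / s * s" using X s by (intro mult_left_mono) (auto simp: t_def)
  also have "\<dots> < 1" using s by (simp add: t_def)
  finally show "t / s * snd X < 1" .
qed

lemma Q_interp_error:
  assumes u: "\<And>x y. u (x, y) = x * (x - 1/2) * (x - 1)" and X: "X \<in> region K"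
  shows "u X - Q_interp 2 K u X =
    err_hat t (xhat (fst X) (t / s * snd X)) (tyhat (fst X) (t / s * snd X))"
proof -
  obtain x y where W: "(x, y) \<in> Khat" "F K (x, y) = X"
    using X half_planes_F_K unfolding region_K by (metis surj_pair)
  define q :: "point \<Rightarrow> real" where "q = (\<lambda>(x, y). cubic_interp x * ((1 - t * y) ^ 3 + t ^ 3 * cubic y)
    - 3/2 * x\<^sup>2 * (1 - t * y)\<^sup>2 + x * (1 - t * y) / 2)"
  \<comment> \<open>The coefficients of the monomials \<open>x\<^sup>i y\<^sup>j\<close> in \<open>q\<close>.\<close>
  define c :: "nat \<Rightarrow> nat \<Rightarrow> real" where "c i j =
    [[0, 0, 0],
     [0, t - t ^ 3 / 4, 3 * t ^ 3 / 4 - 3 * t\<^sup>2 / 2],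
     [0, 3 * t ^ 3 / 4 - 3 * t / 2, 3 * t\<^sup>2 - 9 * t ^ 3 / 4]] ! i ! j" for i j
  have Qhat: "Qhat 2 (u \<circ> F K) = q"
    unfolding Qhat_def
  proof (rule the1_equality[OF Qhat_ex1], simp, intro conjI)
    show "q \<in> Q_space 2"
      unfolding Q_space_def
    proof (intro CollectI exI[of _ c] ext)
      fix Z show "q Z = (case Z of (x, y) \<Rightarrow> \<Sum>i\<le>2. \<Sum>j\<le>2. c i j * x ^ i * y ^ j)"
        by (cases Z) (simp add: q_def c_def numeral_2_eq_2 cubic_def cubic_interp_def
          power2_eq_square power3_eq_cube field_simps)
    qed
    have "q (x, y) = u (F K (x, y))" if "x \<in> {0, 1/2, 1}" "y \<in> {0, 1/2, 1}" for x y
      using that by (elim insertE emptyE; hypsubst)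
        (simp_all add: q_def F_K u cubic_def cubic_interp_def power2_eq_square power3_eq_cube field_simps)
    then show "\<forall>i\<le>2. \<forall>j\<le>2. q (real j / real 2, real i / real 2) = (u \<circ> F K) (real j / real 2, real i / real 2)"
      by (auto simp: le_Suc_eq numeral_2_eq_2)
  qed
  have "Q_interp 2 K u X = q (x, y)"
    using the_inv_into_f_f[OF inj_on_F_K W(1)] unfolding Q_interp_def Qhat W(2) by simp
  moreover have "u X - q (x, y) = err_hat t x (t * y)"
    by (simp add: W(2)[symmetric] F_K u q_def err_hat_def cubic_def cubic_interp_def
      power2_eq_square power3_eq_cube field_simps)
  ultimately show ?thesis using F_K_inverse[OF W(1)] by (simp add: W(2))
qed

section \<open>Bounds for the seminorms\<close>

lemma region_K_compact: "compact (region K)"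
  unfolding region_def by (intro finite_imp_compact_convex_hull) simp

lemma region_K_subset: "region K \<subseteq> cbox (0, 0) (1, 2 * s)"
  unfolding region_def
  by (intro hull_minimal convex_box) (use s in \<open>auto simp: K_def K_quad_def cbox_Pair_eq\<close>)

lemma diameter_region_K: "0 \<le> diameter (region K)" "diameter (region K) \<le> 2"
proof -
  show "0 \<le> diameter (region K)"
    by (intro diameter_ge_0 compact_imp_bounded region_K_compact)
  show "diameter (region K) \<le> 2"
  proof (rule diameter_le)
    show "norm (Z - W) \<le> 2" if ZW: "Z \<in> region K" "W \<in> region K" for Z W
    proof -
      obtain a b a' b' where *: "Z = (a, b)" "W = (a', b')" by (metis surj_pair)
      have "(a, b) \<in> cbox (0, 0) (1, 2 * s)" "(a', b') \<in> cbox (0, 0) (1, 2 * s)"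
        using ZW region_K_subset unfolding * by blast+
      then have "\<bar>a - a'\<bar> \<le> 1" "\<bar>b - b'\<bar> \<le> 1" using s by (auto simp: cbox_Pair_eq)
      then show ?thesis using norm_Pair_le[of "a - a'" "b - b'"] by (simp add: *)
    qed
  qed simp
qed

lemma measure_region_K: "interior (region K) \<in> lmeasurable" "measure lebesgue (interior (region K)) \<le> 2 * s"
proof -
  show m: "interior (region K) \<in> lmeasurable"
    by (intro lmeasurable_interior compact_imp_bounded region_K_compact)
  have "measure lebesgue (interior (region K)) \<le> measure lebesgue (cbox (0, 0) (1, 2 * s) :: point set)"
    using region_K_subset interior_subset[of "region K"] m by (intro measure_mono_fmeasurable) auto
  also have "\<dots> = 2 * s" using s by (simp add: content_Pair)
  finally show "measure lebesgue (interior (region K)) \<le> 2 * s" .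
qed

lemma seminorm_3_le:
  fixes p :: real
  assumes p: "1 \<le> p" and u: "\<And>x y. u (x, y) = x * (x - 1/2) * (x - 1)"
  shows "0 \<le> sobolev_seminorm 3 p (interior (region K)) u"
    and "sobolev_seminorm 3 p (interior (region K)) u \<le> 6 * (2 * s) powr (1 / p)"
proof -
  define \<Omega> where "\<Omega> = interior (region K)"
  define q where "q = [:0, 1/2, - 3/2, 1 :: real:]"
  have \<Omega>: "open \<Omega>" "\<Omega> \<in> lmeasurable" "measure lebesgue \<Omega> \<le> 2 * s"
    using measure_region_K by (auto simp: \<Omega>_def)
  have uq: "u = (\<lambda>X. poly q (fst X))"
    by (auto simp: fun_eq_iff u q_def field_simps)
  have int: "(LINT X:\<Omega>|lebesgue. \<bar>weak_deriv \<Omega> (i, j) u X\<bar> powr p) =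
      (LINT X:\<Omega>|lebesgue. \<bar>poly (if j = 0 then (pderiv ^^ i) q else 0) (fst X)\<bar> powr p)" for i j
  proof (rule weak_deriv_powr_integral[OF \<Omega>(1)])
    show "has_weak_deriv \<Omega> (i, j) u (\<lambda>X. poly (if j = 0 then (pderiv ^^ i) q else 0) (fst X))"
      unfolding uq by (rule has_weak_deriv_poly_fst[OF \<Omega>(1)])
  qed (intro continuous_intros)
  have q3: "(pderiv ^^ 3) q = [:6:]"
    by (simp add: q_def numeral_3_eq_3 pderiv_pCons)
  have idx: "{\<alpha>. fst \<alpha> + snd \<alpha> = (3::nat)} = {(3, 0), (2, 1), (1, 2), (0, 3)}"
    by (auto simp: prod_eq_iff numeral_3_eq_3 numeral_2_eq_2)
  have "(\<Sum>\<alpha> | fst \<alpha> + snd \<alpha> = 3. LINT X:\<Omega>|lebesgue. \<bar>weak_deriv \<Omega> \<alpha> u X\<bar> powr p) =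
      (LINT X:\<Omega>|lebesgue. 6 powr p)"
    unfolding idx by (simp add: int q3)
  also have "\<dots> = 6 powr p * measure lebesgue \<Omega>"
    using \<Omega>(2) by (simp add: set_lebesgue_integral_def fmeasurable_def)
  finally have *: "sobolev_seminorm 3 p \<Omega> u = (6 powr p * measure lebesgue \<Omega>) powr (1 / p)"
    by (simp add: sobolev_seminorm_def)
  then show "0 \<le> sobolev_seminorm 3 p (interior (region K)) u" by (simp add: \<Omega>_def)
  have "sobolev_seminorm 3 p \<Omega> u \<le> (6 powr p * (2 * s)) powr (1 / p)"
    unfolding * using \<Omega>(3) p by (intro powr_mono2 mult_left_mono) auto
  also have "\<dots> = 6 * (2 * s) powr (1 / p)"
    using p s by (simp add: powr_mult powr_powr)
  finally show "sobolev_seminorm 3 p (interior (region K)) u \<le> 6 * (2 * s) powr (1 / p)"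
    by (simp add: \<Omega>_def)
qed

text \<open>The rectangle \<open>\<bar>X - 1/2\<bar> < d\<close>, \<open>0 < m < d\<close> lies in \<open>K\<^sub>s\<close>. Its height in the variable \<open>Y\<close> is
\<open>d s / t\<close>, and the \<open>Y\<close>-derivative of the error is there at least \<open>t / (16 s)\<close> in absolute value.
The \<open>X\<close>-derivative enters the seminorm only through a nonnegative term.\<close>

lemma seminorm_1_ge:
  fixes p d :: real
  assumes p: "1 \<le> p" and u: "\<And>x y. u (x, y) = x * (x - 1/2) * (x - 1)"
    and d: "0 < d" "d \<le> 1/4"
      "\<And>t X m. \<bar>t - 1\<bar> < d \<Longrightarrow> \<bar>X - 1/2\<bar> \<le> d \<Longrightarrow> 0 \<le> m \<Longrightarrow> m \<le> d \<Longrightarrow> 1/16 \<le> \<bar>err_hat_m t X m\<bar>"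
    and sd: "s < d"
  shows "t / s / 16 * (2 * d * (d / (t / s))) powr (1 / p)
    \<le> sobolev_seminorm 1 p (interior (region K)) (\<lambda>X. u X - Q_interp 2 K u X)"
proof -
  define \<Omega> where "\<Omega> = interior (region K)"
  define \<sigma> where "\<sigma> = t / s"
  have \<sigma>: "\<sigma> > 0" using s by (simp add: \<sigma>_def t_def)
  define e where "e = (\<lambda>X. u X - Q_interp 2 K u X)"
  define g where "g X = \<sigma> * err_hat_m t (fst X) (\<sigma> * snd X)" for X :: point
  define E where "E = (\<lambda>X. err_hat t (xhat (fst X) (\<sigma> * snd X)) (tyhat (fst X) (\<sigma> * snd X)))"
  have \<Omega>: "open \<Omega>" "\<Omega> \<subseteq> region K" by (auto simp: \<Omega>_def interior_subset)
  have jac: "0 < (1 + fst X + \<sigma> * snd X)\<^sup>2 - 4 * (\<sigma> * snd X)" if "X \<in> region K" for X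
    using region_K_jac that by (simp add: \<sigma>_def)
  have eE: "e X = E X" if "X \<in> region K" for X
    using Q_interp_error[OF u] that by (simp add: e_def E_def \<sigma>_def)
  have contg: "continuous_on (region K) g"
    unfolding g_def using jac by (intro continuous_intros continuous_on_err_hat_m) auto
  note contg\<Omega> = continuous_on_subset[OF contg \<Omega>(2)]
  have weak: "has_weak_deriv \<Omega> (0, 1) e g"
  proof -
    show ?thesis
    proof (rule has_weak_deriv_y[OF \<Omega>(1) _ _ contg\<Omega>])
      fix X assume X: "X \<in> \<Omega>"
      have der: "(E has_derivative frechet_derivative E (at X)) (at X)"
        and val: "frechet_derivative E (at X) (0, 1) = g X"
        using err_hat_has_derivative[OF jac] X \<Omega>(2) unfolding E_def g_def by blast+
      show "(e has_derivative frechet_derivative E (at X)) (at X)"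
        by (rule has_derivative_transform_within_open[OF der \<Omega>(1) X]) (use eE \<Omega>(2) in auto)
      show "frechet_derivative E (at X) (0, 1) = g X" by (rule val)
    qed
  qed
  have int_g: "set_integrable lebesgue \<Omega> (\<lambda>X. \<bar>g X\<bar> powr p)"
  proof -
    have "locally_integrable (region K) (\<lambda>X. \<bar>g X\<bar> powr p)"
      using p by (intro continuous_imp_locally_integrable continuous_on_powr' continuous_intros contg) auto
    then have "set_integrable lebesgue (region K) (\<lambda>X. \<bar>g X\<bar> powr p)"
      using region_K_compact by (simp add: locally_integrable_def)
    then show ?thesis by (rule set_integrable_subset) (use \<Omega> in auto)
  qed
  define B where "B = (box (1/2 - d, 0) (1/2 + d, d / \<sigma>) :: point set)"
  have B_iff: "X \<in> B \<longleftrightarrow> 1/2 - d < fst X \<and> fst X < 1/2 + d \<and> 0 < snd X \<and> \<sigma> * snd X < d" for X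
    using \<sigma> by (cases X) (auto simp: B_def mem_box Basis_prod_def ball_Un pos_less_divide_eq mult.commute)
  have "B \<subseteq> region K"
  proof
    fix X assume "X \<in> B"
    then have X: "1/4 < fst X" "fst X < 3/4" "0 < snd X" "\<sigma> * snd X < 1/4" using d by (auto simp: B_iff)
    have "t * snd X = s * (\<sigma> * snd X)" using s by (simp add: \<sigma>_def)
    also have "\<dots> \<le> s * (2 * (1 - fst X))" using X s by (intro mult_left_mono) auto
    finally have 1: "t * snd X \<le> 2 * s * (1 - fst X)" by (simp add: algebra_simps)
    have "1/2 * snd X \<le> t * snd X" using X s by (intro mult_right_mono) (auto simp: t_def)
    also have "\<dots> \<le> s * (1/4)"
      unfolding \<open>t * snd X = s * (\<sigma> * snd X)\<close> using X s by (intro mult_left_mono) auto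
    finally have "snd X \<le> s" using s by simp
    with 1 X show "X \<in> region K"
      by (simp add: region_K half_planes_def)
  qed
  then have B: "B \<subseteq> \<Omega>" unfolding \<Omega>_def by (rule interior_maximal) (simp add: B_def open_box)
  have measB: "measure lebesgue B = 2 * d * (d / \<sigma>)"
  proof -
    have "measure lebesgue B = measure lborel (cbox (1/2 - d, 0) (1/2 + d, d / \<sigma>) :: point set)"
      by (simp add: B_def measure_lborel_box_eq measure_lborel_cbox_eq)
    also have "\<dots> = 2 * d * (d / \<sigma>)" using d \<sigma> by (simp add: content_Pair)
    finally show ?thesis .
  qed
  have gB: "(\<sigma> / 16) powr p \<le> \<bar>g X\<bar> powr p" if "X \<in> B" for X
  proof -
    have "1/16 \<le> \<bar>err_hat_m t (fst X) (\<sigma> * snd X)\<bar>"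
      using that \<sigma> sd s by (intro d(3)) (auto simp: B_iff t_def)
    then have "\<sigma> * (1/16) \<le> \<bar>g X\<bar>"
      using \<sigma> by (simp add: g_def abs_mult)
    then show ?thesis using \<sigma> p by (intro powr_mono2) auto
  qed
  have "(\<sigma> / 16) powr p * measure lebesgue B = (LINT X|lebesgue. indicator B X * (\<sigma> / 16) powr p)"
    by simp
  also have "\<dots> \<le> (LINT X:\<Omega>|lebesgue. \<bar>g X\<bar> powr p)"
    unfolding set_lebesgue_integral_def
  proof (rule integral_mono)
    show "integrable lebesgue (\<lambda>X. indicator \<Omega> X *\<^sub>R \<bar>g X\<bar> powr p)"
      using int_g by (simp add: set_integrable_def)
    have "B \<in> lmeasurable" by (simp add: B_def)
    then show "integrable lebesgue (\<lambda>X. indicator B X * (\<sigma> / 16) powr p)"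
      by (auto simp: fmeasurable_def)
    show "indicator B X * (\<sigma> / 16) powr p \<le> indicator \<Omega> X *\<^sub>R \<bar>g X\<bar> powr p" for X
      using B gB[of X] by (auto simp: indicator_def)
  qed
  also have "\<dots> = (LINT X:\<Omega>|lebesgue. \<bar>weak_deriv \<Omega> (0, 1) e X\<bar> powr p)"
    by (rule weak_deriv_powr_integral[OF \<Omega>(1) weak contg\<Omega>, symmetric])
  also have "\<dots> \<le> (\<Sum>\<alpha> | fst \<alpha> + snd \<alpha> = 1. LINT X:\<Omega>|lebesgue. \<bar>weak_deriv \<Omega> \<alpha> e X\<bar> powr p)"
  proof -
    have "{\<alpha>. fst \<alpha> + snd \<alpha> = (1::nat)} = {(1, 0), (0, 1)}" by (auto simp: prod_eq_iff)
    moreover have "0 \<le> (LINT X:\<Omega>|lebesgue. \<bar>weak_deriv \<Omega> (1, 0) e X\<bar> powr p)"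
      unfolding set_lebesgue_integral_def by (rule Bochner_Integration.integral_nonneg) simp
    ultimately show ?thesis by simp
  qed
  finally have "((\<sigma> / 16) powr p * measure lebesgue B) powr (1 / p) \<le> sobolev_seminorm 1 p \<Omega> e"
    unfolding sobolev_seminorm_def using p by (intro powr_mono2) auto
  moreover have "((\<sigma> / 16) powr p * measure lebesgue B) powr (1 / p) = \<sigma> / 16 * measure lebesgue B powr (1 / p)"
    using p \<sigma> by (simp add: powr_mult powr_powr)
  ultimately show ?thesis by (simp add: measB \<sigma>_def \<Omega>_def e_def)
qed

end

theorem mainTheorem2:
  fixes p :: real and K :: "real \<Rightarrow> quad" and u :: "point \<Rightarrow> real"
  assumes "1 \<le> p" and "p < 3"
    and K: "\<And>s. K s = K_quad 1 s s (2 * s)"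
    and u: "\<And>x y. u (x, y) = x * (x - 1/2) * (x - 1)"
  shows "(\<forall>s. 0 < s \<and> s < 1/2 \<longrightarrow> convex_quad (K s))
    \<and> (\<forall>s. 0 < s \<and> s < 1/2 \<longrightarrow> RDP (sqrt 5) (3 * pi / 4) (K s) \<and> MAC (3 * pi / 4) (K s))
    \<and> \<not> (\<exists>\<psi>>0. \<forall>s. 0 < s \<and> s < 1/2 \<longrightarrow> mac \<psi> (K s))
    \<and> \<not> (\<exists>C. \<forall>s. 0 < s \<and> s < 1/2 \<longrightarrow>
          sobolev_seminorm 1 p (interior (region (K s))) (\<lambda>X. u X - Q_interp 2 (K s) u X)
            \<le> C * (diameter (region (K s)))\<^sup>2 * sobolev_seminorm 3 p (interior (region (K s))) u)"
proof (intro conjI)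
  show "\<forall>s. 0 < s \<and> s < 1/2 \<longrightarrow> convex_quad (K s)"
    using K_quad_convex by (simp add: K)
  show "\<forall>s. 0 < s \<and> s < 1/2 \<longrightarrow> RDP (sqrt 5) (3 * pi / 4) (K s) \<and> MAC (3 * pi / 4) (K s)"
    using K_quad_RDP K_quad_MAC by (simp add: K)
  show "\<not> (\<exists>\<psi>>0. \<forall>s. 0 < s \<and> s < 1/2 \<longrightarrow> mac \<psi> (K s))"
    using K_quad_not_mac unfolding K by blast
  show "\<not> (\<exists>C. \<forall>s. 0 < s \<and> s < 1/2 \<longrightarrow>
          sobolev_seminorm 1 p (interior (region (K s))) (\<lambda>X. u X - Q_interp 2 (K s) u X)
            \<le> C * (diameter (region (K s)))\<^sup>2 * sobolev_seminorm 3 p (interior (region (K s))) u)"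
  proof
    assume "\<exists>C. \<forall>s. 0 < s \<and> s < 1/2 \<longrightarrow>
          sobolev_seminorm 1 p (interior (region (K s))) (\<lambda>X. u X - Q_interp 2 (K s) u X)
            \<le> C * (diameter (region (K s)))\<^sup>2 * sobolev_seminorm 3 p (interior (region (K s))) u"
    then obtain C where C: "\<And>s. 0 < s \<Longrightarrow> s < 1/2 \<Longrightarrow>
          sobolev_seminorm 1 p (interior (region (K s))) (\<lambda>X. u X - Q_interp 2 (K s) u X)
            \<le> C * (diameter (region (K s)))\<^sup>2 * sobolev_seminorm 3 p (interior (region (K s))) u" by blast
    obtain d where d: "0 < d" "d \<le> 1/4"
      "\<And>t X m. \<bar>t - 1\<bar> < d \<Longrightarrow> \<bar>X - 1/2\<bar> \<le> d \<Longrightarrow> 0 \<le> m \<Longrightarrow> m \<le> d \<Longrightarrow> 1/16 \<le> \<bar>err_hat_m t X m\<bar>"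
      using err_hat_m_bound_near by blast
    \<comment> \<open>For \<open>s < d\<close> the two seminorm bounds and \<open>h\<^sub>s \<le> 2\<close> leave
      \<open>(1 - s)/(16 s) \<cdot> (2 d\<^sup>2 s)\<^bsup>1/p\<^esup> \<le> 4 \<bar>C\<bar> \<cdot> 6 (2 s)\<^bsup>1/p\<^esup>\<close>, and \<open>384 = 16 \<cdot> 24\<close>.\<close>
    define M where "M = 384 * \<bar>C\<bar> / (d\<^sup>2) powr (1 / p)"
    have "M \<ge> 0" by (simp add: M_def)
    have bound: "(1 - s) / s \<le> M" if s: "0 < s" "s < d" for s
    proof -
      have s': "s < 1/2" using s d by simp
      define r where "r = 1 / p"
      define h where "h = diameter (region (K s))"
      have h: "0 \<le> h" "h \<le> 2" using diameter_region_K[OF s(1) s'] by (simp_all add: h_def K)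
      have h2: "h\<^sup>2 \<le> 4" using power_mono[OF h(2) h(1), of 2] by simp
      have S3: "0 \<le> sobolev_seminorm 3 p (interior (region (K s))) u"
        "sobolev_seminorm 3 p (interior (region (K s))) u \<le> 6 * (2 * s) powr r"
        using seminorm_3_le[OF s(1) s' \<open>1 \<le> p\<close> u] by (simp_all add: K r_def)
      have "d\<^sup>2 * (2 * s) \<le> 2 * d * (d / ((1 - s) / s))"
        using s s' d by (simp add: field_simps power2_eq_square)
      then have "(d\<^sup>2 * (2 * s)) powr r \<le> (2 * d * (d / ((1 - s) / s))) powr r"
        using s d \<open>1 \<le> p\<close> by (intro powr_mono2) (auto simp: r_def)
      then have "(1 - s) / s / 16 * ((d\<^sup>2) powr r * (2 * s) powr r)
          \<le> (1 - s) / s / 16 * (2 * d * (d / ((1 - s) / s))) powr r"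
        using s s' by (intro mult_left_mono) (auto simp: powr_mult)
      also have "\<dots> \<le> C * h\<^sup>2 * sobolev_seminorm 3 p (interior (region (K s))) u"
        using seminorm_1_ge[OF s(1) s' \<open>1 \<le> p\<close> u d s(2)] C[OF s(1) s'] by (simp add: K r_def h_def)
      also have "\<dots> \<le> \<bar>C\<bar> * 4 * (6 * (2 * s) powr r)"
        using S3 h2 by (intro mult_mono) auto
      finally have le: "(1 - s) / s / 16 * ((d\<^sup>2) powr r * (2 * s) powr r) \<le> \<bar>C\<bar> * 4 * (6 * (2 * s) powr r)" .
      have cancel: "x * a \<le> 384 * \<bar>C\<bar>" if "x / 16 * (a * c) \<le> \<bar>C\<bar> * 4 * (6 * c)" "0 < c" for x a c :: real
      proof (rule mult_right_le_imp_le)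
        show "x * a * c \<le> 384 * \<bar>C\<bar> * c" using that(1) by (simp add: field_simps)
      qed fact
      have "(1 - s) / s * (d\<^sup>2) powr r \<le> 384 * \<bar>C\<bar>"
        by (rule cancel[OF le]) (use s in simp)
      moreover have "0 < (d\<^sup>2) powr r" using d by simp
      ultimately show ?thesis unfolding M_def r_def[symmetric] by (simp only: pos_le_divide_eq)
    qed
    define s where "s = min (d / 2) (1 / (M + 2))"
    have s: "0 < s" "s < d" "s \<le> 1 / (M + 2)" using d \<open>M \<ge> 0\<close> by (auto simp: s_def)
    have "M + 2 \<le> 1 / s" using s \<open>M \<ge> 0\<close> by (simp add: field_simps)
    moreover have "(1 - s) / s = 1 / s - 1" using s by (simp add: field_simps)
    ultimately show False using bound[OF s(1,2)] by linarith
  qed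
qed

end
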